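(* Let $\alpha>0$, $n\in\mathbb N$, and for $k\in\{0,\dots,n-1\}$ let $p_k(x)=\sum_{m=0}^\infty p_{mk}x^{m\alpha}$, $x\in[0,\rho_k)$, be $\alpha$-analytic functions. Let $\rho=\min\{\rho_0,\dots,\rho_{n-1}\}$. Then for any given initial values $b_0,\dots,b_{n-1}$ the equation $$\mathbb D_\alpha^{n}y+p_{n-1}(x)\mathbb D_\alpha^{n-1}y+\dots+p_1(x)\mathbb D_\alpha y+p_0(x)y=0$$ with the initial conditions $$y(0)=b_0,\quad \mathbb D_\alpha y(0)=b_1,\ \dots,\ \mathbb D_\alpha^{n-1}y(0)=b_{n-1}$$ has a unique $\alpha$-analytic solution $y(x)=\sum_{m=0}^\infty a_mx^{m\alpha}$, $x\in[0,\rho)$.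
   Context: A function $u$ is $\alpha$-analytic on $[0,\rho)$, $0<\rho\le\infty$, if $u(t)=\sum_{m=0}^\infty u_mt^{\alpha m}$ with the series converging for all $0\le t<\rho$. $\mathbb D_\alpha$ is the Caputo-Djrbashian fractional derivative of order $\alpha$: for $l-1<\alpha\le l$, $l\in\mathbb N$, $$(\mathbb D_\alpha\varphi)(x)=D^\alpha\Big(\varphi(x)-\sum_{k=0}^{l-1}\frac{\varphi^{(k)}(0)}{k!}x^k\Big),$$ where $D^\alpha\varphi=\frac{d^l}{dx^l}I^{l-\alpha}\varphi$ is the Riemann-Liouville derivative, $I^{\beta}\varphi(x)=\frac1{\Gamma(\beta)}\int_0^x(x-t)^{\beta-1}\varphi(t)\,dt$ for $\beta>0$, and $I^0\varphi=\varphi$. $\mathbb D_\alpha^{j}$ denotes the $j$-th iterate of $\mathbb D_\alpha$. On an $\alpha$-analytic function $u(t)=\sum_{m\ge0}u_mt^{\alpha m}$ it acts termwise: $$(\mathbb D_\alpha^{j}u)(t)=\sum_{m=0}^\infty u_{m+j}\frac{\Gamma((m+j)\alpha+1)}{\Gamma(m\alpha+1)}t^{\alpha m},$$ and the value at $0$ is the value of this series at $t=0$. *)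

theory Defs
  imports "HOL-Analysis.Analysis"
begin

definition right_open_ivl :: "ereal \<Rightarrow> real set" where
  "right_open_ivl \<rho> = {t. 0 \<le> t \<and> ereal t < \<rho>}"

(* The power t^(alpha*m) is written (t powr alpha)^m rather than t powr (alpha*m):
   in HOL 0 powr 0 = 0, so the latter would drop the constant term at t = 0.
   Scalars range over 'a :: {real_normed_field, banach}, i.e. (up to isomorphism)
   over the reals or the complex numbers. *)
definition alpha_analytic :: "real \<Rightarrow> ereal \<Rightarrow> (real \<Rightarrow> 'a::{real_normed_field,banach}) \<Rightarrow> bool" where
  "alpha_analytic \<alpha> \<rho> u \<longleftrightarrow>
     (\<exists>c::nat \<Rightarrow> 'a. \<forall>t\<in>right_open_ivl \<rho>. (\<lambda>m. ((t powr \<alpha>) ^ m) *\<^sub>R c m) sums u t)"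

(* Functions live on intervals [0, rho), so derivatives are taken within {0..}: two-sided at
   x > 0, from the right at x = 0. They are local, hence at points of [0, rho) independent of
   the values of the function outside [0, rho). *)
definition half_line_deriv :: "(real \<Rightarrow> 'a::real_normed_vector) \<Rightarrow> real \<Rightarrow> 'a" where
  "half_line_deriv f x = vector_derivative f (at x within {0..})"

definition frac_integral :: "real \<Rightarrow> (real \<Rightarrow> 'a::banach) \<Rightarrow> real \<Rightarrow> 'a" where
  "frac_integral \<beta> \<phi> x =
     (if \<beta> = 0 then \<phi> x
      else (1 / Gamma \<beta>) *\<^sub>R integral {0..x} (\<lambda>t. ((x - t) powr (\<beta> - 1)) *\<^sub>R \<phi> t))"

(* For alpha > 0 the natural number l with l - 1 < alpha <= l. *)
definition frac_order :: "real \<Rightarrow> nat" where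
  "frac_order \<alpha> = nat \<lceil>\<alpha>\<rceil>"

definition riemann_liouville_deriv :: "real \<Rightarrow> (real \<Rightarrow> 'a::banach) \<Rightarrow> real \<Rightarrow> 'a" where
  "riemann_liouville_deriv \<alpha> \<phi> =
     (half_line_deriv ^^ frac_order \<alpha>) (frac_integral (real (frac_order \<alpha>) - \<alpha>) \<phi>)"

definition caputo_deriv :: "real \<Rightarrow> (real \<Rightarrow> 'a::banach) \<Rightarrow> real \<Rightarrow> 'a" where
  "caputo_deriv \<alpha> \<phi> =
     riemann_liouville_deriv \<alpha>
       (\<lambda>x. \<phi> x - (\<Sum>k<frac_order \<alpha>. (x ^ k / fact k) *\<^sub>R (half_line_deriv ^^ k) \<phi> 0))"

(* For alpha-analytic y all derivatives and integrals involved exist on [0, rho), including the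
   right derivatives at 0, so no totalised junk values enter. *)
definition solves_frac_ivp ::
  "real \<Rightarrow> nat \<Rightarrow> ereal \<Rightarrow> (nat \<Rightarrow> real \<Rightarrow> 'a::{real_normed_field,banach}) \<Rightarrow> (nat \<Rightarrow> 'a) \<Rightarrow>
     (real \<Rightarrow> 'a) \<Rightarrow> bool" where
  "solves_frac_ivp \<alpha> n \<rho> p b y \<longleftrightarrow>
     (\<forall>x\<in>right_open_ivl \<rho>.
        (caputo_deriv \<alpha> ^^ n) y x + (\<Sum>k<n. p k x * (caputo_deriv \<alpha> ^^ k) y x) = 0) \<and>
     (\<forall>k<n. (caputo_deriv \<alpha> ^^ k) y 0 = b k)"

end

theory Submission
  imports Defs
begin

text \<open>In \<open>w = x powr \<alpha>\<close> everything is a power series, on which the Caputo derivative acts as a weighted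
  shift of the coefficients. The equation therefore becomes a recursion that determines the
  coefficients from the initial values. For convergence fix a radius \<open>w'\<close> inside the domain of the
  \<open>p k\<close> and put \<open>z m = norm (a m) * w' ^ m\<close>; the recursion yields
  \<open>z (m + n) \<le> \<epsilon> m * (\<Sum>j<m + n. z j)\<close> with \<open>\<epsilon> m\<close> tending to \<open>0\<close>, so the partial sums of \<open>z\<close> grow
  slower than every geometric sequence and the series converges for \<open>w < w'\<close>.\<close>

section \<open>Series in powers of \<open>t powr \<alpha>\<close>\<close>

text \<open>On a term of exponent \<open>\<alpha> * (m + 1)\<close> the Caputo derivative acts in
  three moves whose factors telescope. Subtracting the Taylor polynomial removes only the constant
  term. The integral of order \<open>l - \<alpha>\<close> raises the exponent to
  \<open>\<alpha> * m + l\<close> at the price of a Gamma quotient. The \<open>l\<close> ordinary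
  derivatives lower it to \<open>\<alpha> * m\<close> and cancel the intermediate Gamma value. The
  obstacle is the endpoint 0. Right derivatives at 0 enter the definition, yet for
  \<open>\<alpha> < 1\<close> the function \<open>t powr \<alpha>\<close> has none. Every series
  that is differentiated at 0 therefore carries an explicit prefactor \<open>t powr s\<close> with
  \<open>s \<ge> 1\<close>, and the exponent \<open>s\<close> is tracked through all operations. The
  smallness of \<open>\<epsilon> m\<close> comes from the order of the equation: the leading term
  carries \<open>n\<close> fractional derivatives and every other term fewer, so solving for the
  leading coefficient divides by the fastest growing Gamma quotient.\<close>

definition norm_conv :: "real \<Rightarrow> ereal \<Rightarrow> (nat \<Rightarrow> 'a::real_normed_vector) \<Rightarrow> bool" where
  "norm_conv \<alpha> \<rho> c \<longleftrightarrow>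
     (\<forall>t\<in>right_open_ivl \<rho>. summable (\<lambda>m. norm (c m) * (t powr \<alpha>) ^ m))"

definition alpha_series :: "real \<Rightarrow> (nat \<Rightarrow> 'a::{real_normed_field,banach}) \<Rightarrow> real \<Rightarrow> 'a" where
  "alpha_series \<alpha> c t = (\<Sum>m. ((t powr \<alpha>) ^ m) *\<^sub>R c m)"

text \<open>For \<open>s = 0\<close> the prefactor must be \<open>1\<close> also at \<open>t = 0\<close>, whereas \<open>0 powr 0 = 0\<close>.\<close>

definition shifted_series ::
  "real \<Rightarrow> real \<Rightarrow> (nat \<Rightarrow> 'a::{real_normed_field,banach}) \<Rightarrow> real \<Rightarrow> 'a" where
  "shifted_series \<alpha> s c t = (if s = 0 then 1 else t powr s) *\<^sub>R alpha_series \<alpha> c t"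

lemma right_open_ivl_nonneg: "t \<in> right_open_ivl \<rho> \<Longrightarrow> 0 \<le> t"
  by (simp add: right_open_ivl_def)

lemma right_open_ivl_downward:
  "t \<in> right_open_ivl \<rho> \<Longrightarrow> 0 \<le> s \<Longrightarrow> s \<le> t \<Longrightarrow> s \<in> right_open_ivl \<rho>"
  using order.strict_trans1[of "ereal s" "ereal t" \<rho>] by (simp add: right_open_ivl_def)

lemma right_open_ivl_larger:
  assumes "t \<in> right_open_ivl \<rho>"
  obtains t' where "t' \<in> right_open_ivl \<rho>" "t < t'"
proof -
  from assms have "ereal t < \<rho>" "0 \<le> t" by (auto simp: right_open_ivl_def)
  then obtain t' where "ereal t < ereal t'" "ereal t' < \<rho>" using ereal_dense2 by blast
  with \<open>0 \<le> t\<close> show ?thesis by (intro that[of t']) (auto simp: right_open_ivl_def)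
qed

text \<open>Every point of a right-open interval lies strictly below another of its points, and a
  power series that converges at a larger radius converges absolutely at a smaller one. Absolute
  convergence can thus serve as the working notion, being stable under comparison and
  products.\<close>

lemma norm_conv_iff:
  fixes c :: "nat \<Rightarrow> 'a::{real_normed_field,banach}"
  assumes "\<alpha> > 0"
  shows "norm_conv \<alpha> \<rho> c \<longleftrightarrow> (\<forall>t\<in>right_open_ivl \<rho>. summable (\<lambda>m. ((t powr \<alpha>) ^ m) *\<^sub>R c m))"
proof
  assume *: "norm_conv \<alpha> \<rho> c"
  show "\<forall>t\<in>right_open_ivl \<rho>. summable (\<lambda>m. ((t powr \<alpha>) ^ m) *\<^sub>R c m)"
  proof
    fix t assume "t \<in> right_open_ivl \<rho>"
    with * have "summable (\<lambda>m. norm (((t powr \<alpha>) ^ m) *\<^sub>R c m))"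
      by (simp add: norm_conv_def mult.commute)
    then show "summable (\<lambda>m. ((t powr \<alpha>) ^ m) *\<^sub>R c m)" by (rule summable_norm_cancel)
  qed
next
  assume *: "\<forall>t\<in>right_open_ivl \<rho>. summable (\<lambda>m. ((t powr \<alpha>) ^ m) *\<^sub>R c m)"
  show "norm_conv \<alpha> \<rho> c" unfolding norm_conv_def
  proof
    fix t assume t: "t \<in> right_open_ivl \<rho>"
    then obtain t' where t': "t' \<in> right_open_ivl \<rho>" "t < t'" by (rule right_open_ivl_larger)
    have "t powr \<alpha> < t' powr \<alpha>"
      using assms t t' by (intro powr_less_mono2) (auto simp: right_open_ivl_def)
    moreover have "summable (\<lambda>m. c m * (of_real (t' powr \<alpha>)) ^ m)"
      using *[rule_format, OF t'(1)] by (simp add: scaleR_conv_of_real mult.commute)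
    ultimately have "summable (\<lambda>m. norm (c m * (of_real (t powr \<alpha>)) ^ m))"
      by (intro powser_insidea) auto
    then show "summable (\<lambda>m. norm (c m) * (t powr \<alpha>) ^ m)"
      by (simp add: norm_mult norm_power)
  qed
qed

lemma norm_conv_series:
  fixes c :: "nat \<Rightarrow> 'a::{real_normed_field,banach}"
  assumes "\<alpha> > 0" "norm_conv \<alpha> \<rho> c" "t \<in> right_open_ivl \<rho>"
  shows "(\<lambda>m. ((t powr \<alpha>) ^ m) *\<^sub>R c m) sums alpha_series \<alpha> c t"
  unfolding alpha_series_def
  by (rule summable_sums, rule bspec[OF iffD1[OF norm_conv_iff[OF assms(1)] assms(2)] assms(3)])

lemma alpha_analytic_iff:
  assumes "\<alpha> > 0"
  shows "alpha_analytic \<alpha> \<rho> u \<longleftrightarrow>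
    (\<exists>c. norm_conv \<alpha> \<rho> c \<and> (\<forall>t\<in>right_open_ivl \<rho>. u t = alpha_series \<alpha> c t))"
proof -
  have "(\<forall>t\<in>right_open_ivl \<rho>. (\<lambda>m. ((t powr \<alpha>) ^ m) *\<^sub>R c m) sums u t) \<longleftrightarrow>
    norm_conv \<alpha> \<rho> c \<and> (\<forall>t\<in>right_open_ivl \<rho>. u t = alpha_series \<alpha> c t)" for c
    unfolding norm_conv_iff[OF assms] alpha_series_def sums_iff by metis
  then show ?thesis unfolding alpha_analytic_def by simp
qed

section \<open>Operations on coefficients that preserve convergence\<close>

lemma norm_conv_mono:
  assumes "norm_conv \<alpha> \<rho> c" "\<rho>' \<le> \<rho>"
  shows "norm_conv \<alpha> \<rho>' c"
proof -
  have "right_open_ivl \<rho>' \<subseteq> right_open_ivl \<rho>"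
    using assms(2) by (auto simp: right_open_ivl_def intro: less_le_trans)
  then show ?thesis using assms(1) unfolding norm_conv_def by blast
qed

lemma norm_conv_bounded_mult:
  fixes c :: "nat \<Rightarrow> 'a::real_normed_vector"
  assumes "norm_conv \<alpha> \<rho> c" "\<And>m. \<bar>a m\<bar> \<le> K"
  shows "norm_conv \<alpha> \<rho> (\<lambda>m. a m *\<^sub>R c m)"
  unfolding norm_conv_def
proof
  fix t assume "t \<in> right_open_ivl \<rho>"
  then have "summable (\<lambda>m. K * (norm (c m) * (t powr \<alpha>) ^ m))"
    using assms by (intro summable_mult) (auto simp: norm_conv_def)
  then show "summable (\<lambda>m. norm (a m *\<^sub>R c m) * (t powr \<alpha>) ^ m)"
    by (rule summable_comparison_test'[where N = 0])
      (use assms(2) in \<open>auto simp: mult.assoc intro!: mult_right_mono\<close>)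
qed

lemma norm_conv_add:
  fixes c d :: "nat \<Rightarrow> 'a::real_normed_vector"
  assumes "norm_conv \<alpha> \<rho> c" "norm_conv \<alpha> \<rho> d"
  shows "norm_conv \<alpha> \<rho> (\<lambda>m. c m + d m)"
  unfolding norm_conv_def
proof
  fix t assume "t \<in> right_open_ivl \<rho>"
  then have "summable (\<lambda>m. norm (c m) * (t powr \<alpha>) ^ m + norm (d m) * (t powr \<alpha>) ^ m)"
    using assms by (intro summable_add) (auto simp: norm_conv_def)
  then show "summable (\<lambda>m. norm (c m + d m) * (t powr \<alpha>) ^ m)"
    by (rule summable_comparison_test')
      (auto simp: ring_distribs[symmetric] intro!: mult_right_mono norm_triangle_ineq)
qed

text \<open>The gap between \<open>t\<close> and a larger \<open>t'\<close> absorbs the linear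
  growth of the weights: up to an index shift these are the terms of the formal derivative of the
  real power series with coefficients \<open>norm (c m)\<close>.\<close>

lemma norm_conv_index_mult:
  fixes c :: "nat \<Rightarrow> 'a::real_normed_vector"
  assumes "\<alpha> > 0" "norm_conv \<alpha> \<rho> c"
  shows "norm_conv \<alpha> \<rho> (\<lambda>m. real m *\<^sub>R c m)"
  unfolding norm_conv_def
proof
  fix t assume t: "t \<in> right_open_ivl \<rho>"
  then obtain t' where t': "t' \<in> right_open_ivl \<rho>" "t < t'" by (rule right_open_ivl_larger)
  have lt: "t powr \<alpha> < t' powr \<alpha>"
    using assms t t' by (intro powr_less_mono2) (auto simp: right_open_ivl_def)
  have "summable (\<lambda>m. norm (c m) * (t' powr \<alpha>) ^ m)"
    using assms t' by (auto simp: norm_conv_def)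
  then have "summable (\<lambda>m. norm (c m) * x ^ m)" if "norm x < t' powr \<alpha>" for x
    using that powser_inside by force
  then have "summable (\<lambda>m. diffs (\<lambda>m. norm (c m)) m * (t powr \<alpha>) ^ m)"
    using lt by (intro termdiff_converges) auto
  then have "summable (\<lambda>m. diffs (\<lambda>m. norm (c m)) m * (t powr \<alpha>) ^ m * (t powr \<alpha>))"
    by (rule summable_mult2)
  then have "summable (\<lambda>m. norm (real (Suc m) *\<^sub>R c (Suc m)) * (t powr \<alpha>) ^ Suc m)"
    by (simp add: diffs_def mult_ac)
  then show "summable (\<lambda>m. norm (real m *\<^sub>R c m) * (t powr \<alpha>) ^ m)"
    by (subst (asm) summable_Suc_iff)
qed

lemma norm_conv_affine_mult:
  fixes c :: "nat \<Rightarrow> 'a::real_normed_vector"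
  assumes "\<alpha> > 0" "norm_conv \<alpha> \<rho> c"
  shows "norm_conv \<alpha> \<rho> (\<lambda>m. (\<alpha> * real m + s) *\<^sub>R c m)"
proof -
  have "norm_conv \<alpha> \<rho> (\<lambda>m. \<alpha> *\<^sub>R (real m *\<^sub>R c m))"
    by (rule norm_conv_bounded_mult[OF norm_conv_index_mult[OF assms] order_refl])
  moreover have "norm_conv \<alpha> \<rho> (\<lambda>m. s *\<^sub>R c m)"
    by (rule norm_conv_bounded_mult[OF assms(2) order_refl])
  ultimately have "norm_conv \<alpha> \<rho> (\<lambda>m. \<alpha> *\<^sub>R (real m *\<^sub>R c m) + s *\<^sub>R c m)"
    by (rule norm_conv_add)
  then show ?thesis by (simp add: scaleR_add_left)
qed

lemma norm_conv_Suc: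
  fixes c :: "nat \<Rightarrow> 'a::real_normed_vector"
  assumes "\<alpha> > 0" "norm_conv \<alpha> \<rho> c"
  shows "norm_conv \<alpha> \<rho> (\<lambda>m. c (Suc m))"
  unfolding norm_conv_def
proof
  fix t assume t: "t \<in> right_open_ivl \<rho>"
  then have "summable (\<lambda>m. norm (c (Suc m)) * (t powr \<alpha>) ^ Suc m)"
    using assms(2) by (subst summable_Suc_iff) (auto simp: norm_conv_def)
  then have "summable (\<lambda>m. inverse (t powr \<alpha>) * (norm (c (Suc m)) * (t powr \<alpha>) ^ Suc m))"
    by (rule summable_mult)
  \<comment> \<open>Dividing by \<open>t powr \<alpha>\<close> fails at \<open>t = 0\<close>, but
    there only the term with \<open>m = 0\<close> is nonzero.\<close>
  moreover have "t = 0 \<or> (\<lambda>m. inverse (t powr \<alpha>) * (norm (c (Suc m)) * (t powr \<alpha>) ^ Suc m))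
      = (\<lambda>m. norm (c (Suc m)) * (t powr \<alpha>) ^ m)"
    by (cases "t = 0") (simp_all add: fun_eq_iff)
  ultimately show "summable (\<lambda>m. norm (c (Suc m)) * (t powr \<alpha>) ^ m)"
    by (cases "t = 0") (simp, simp only: simp_thms)
qed

lemma alpha_series_0 [simp]: "alpha_series \<alpha> c 0 = c 0"
proof -
  have "(\<lambda>m. ((0 powr \<alpha>) ^ m) *\<^sub>R c m) sums ((0 powr \<alpha>) ^ 0 *\<^sub>R c 0)"
    by (rule sums_finite[of "{0}", simplified]) auto
  then show ?thesis unfolding alpha_series_def by (simp add: sums_iff)
qed

text \<open>Isolates the constant term, which the Caputo derivative subtracts, from a remainder that
  has the prefactor form used for integration and differentiation.\<close>

lemma alpha_series_split:
  fixes c :: "nat \<Rightarrow> 'a::{real_normed_field,banach}"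
  assumes "\<alpha> > 0" "norm_conv \<alpha> \<rho> c" "t \<in> right_open_ivl \<rho>"
  shows "alpha_series \<alpha> c t = c 0 + shifted_series \<alpha> \<alpha> (\<lambda>m. c (Suc m)) t"
proof -
  have "(\<lambda>m. ((t powr \<alpha>) ^ m) *\<^sub>R c (Suc m)) sums alpha_series \<alpha> (\<lambda>m. c (Suc m)) t"
    by (intro norm_conv_series[OF assms(1) _ assms(3)] norm_conv_Suc assms)
  then have "(\<lambda>m. (t powr \<alpha>) *\<^sub>R ((t powr \<alpha>) ^ m) *\<^sub>R c (Suc m)) sums
      ((t powr \<alpha>) *\<^sub>R alpha_series \<alpha> (\<lambda>m. c (Suc m)) t)"
    by (rule sums_scaleR_right)
  then have "(\<lambda>m. ((t powr \<alpha>) ^ Suc m) *\<^sub>R c (Suc m)) sums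
      (shifted_series \<alpha> \<alpha> (\<lambda>m. c (Suc m)) t)"
    using assms(1) by (simp add: shifted_series_def)
  from sums_Suc[where f = "\<lambda>m. ((t powr \<alpha>) ^ m) *\<^sub>R c m", OF this] show ?thesis
    unfolding alpha_series_def[of _ c] by (simp add: sums_iff add.commute)
qed

section \<open>Termwise differentiation\<close>

text \<open>For \<open>w = t powr \<alpha>\<close> the derivative is
  \<open>\<alpha> * w / t\<close>. Writing it with \<open>1 / t\<close> leaves the powers of
  \<open>w\<close> unshifted, so the result is again a series of the same kind; the price is the
  restriction to \<open>t > 0\<close>.\<close>

lemma has_vector_derivative_alpha_series:
  fixes c :: "nat \<Rightarrow> 'a::{real_normed_field,banach}"
  assumes "\<alpha> > 0" "norm_conv \<alpha> \<rho> c" "t \<in> right_open_ivl \<rho>" "t > 0"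
  shows "(alpha_series \<alpha> c has_vector_derivative
     (1 / t) *\<^sub>R alpha_series \<alpha> (\<lambda>m. (\<alpha> * real m) *\<^sub>R c m) t) (at t within X)"
proof -
  obtain t' where t': "t' \<in> right_open_ivl \<rho>" "t < t'" 
    using assms(3) by (rule right_open_ivl_larger)
  define g where "g = (\<lambda>z::'a. \<Sum>n. c n * z ^ n)"
  define w where "w = t powr \<alpha>"
  have w: "w > 0" using assms by (simp add: w_def)
  have lt: "w < t' powr \<alpha>"
    unfolding w_def using assms t' by (intro powr_less_mono2) auto
  have sm: "summable (\<lambda>m. c m * (of_real (t' powr \<alpha>)) ^ m)"
    using norm_conv_series[OF assms(1,2) t'(1)]
    by (simp add: scaleR_conv_of_real mult.commute sums_iff)
  define D where "D = (\<Sum>n. diffs c n * of_real w ^ n)"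
  have "DERIV g (of_real w) :> D"
    unfolding g_def D_def using lt w by (intro termdiffs_strong[OF sm]) auto
  then have "((\<lambda>x. g (of_real x)) has_vector_derivative D) (at w within (\<lambda>x. x powr \<alpha>) ` X)"
    by (rule has_vector_derivative_real_field)
  moreover have "((\<lambda>x. x powr \<alpha>) has_vector_derivative (\<alpha> * t powr (\<alpha> - 1))) (at t within X)"
    using assms by (auto simp flip: has_real_derivative_iff_has_vector_derivative
        intro!: derivative_eq_intros)
  ultimately have "((\<lambda>x. g (of_real x)) \<circ> (\<lambda>x. x powr \<alpha>) has_vector_derivative
      (\<alpha> * t powr (\<alpha> - 1)) *\<^sub>R D) (at t within X)"
    unfolding w_def by (intro vector_diff_chain_within)
  moreover have "(\<lambda>x. g (of_real x)) \<circ> (\<lambda>x. x powr \<alpha>) = alpha_series \<alpha> c"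
    by (simp add: fun_eq_iff g_def alpha_series_def scaleR_conv_of_real mult.commute)
  moreover have "(\<alpha> * t powr (\<alpha> - 1)) *\<^sub>R D = (1 / t) *\<^sub>R alpha_series \<alpha> (\<lambda>m. (\<alpha> * real m) *\<^sub>R c m) t"
  proof -
    have "summable (\<lambda>m. diffs c m * of_real w ^ m)"
    proof (rule termdiff_converges[of _ "t' powr \<alpha>"])
      show "norm (of_real w :: 'a) < t' powr \<alpha>" using w lt by simp
      show "summable (\<lambda>n. c n * x ^ n)" if "norm x < t' powr \<alpha>" for x
        using powser_inside[OF sm, of x] that by simp
    qed
    then have "(\<lambda>m. diffs c m * of_real w ^ m) sums D" unfolding D_def by (rule summable_sums)
    then have "(\<lambda>m. (\<alpha> * w) *\<^sub>R (diffs c m * of_real w ^ m)) sums ((\<alpha> * w) *\<^sub>R D)"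
      by (rule sums_scaleR_right)
    then have "(\<lambda>m. w ^ Suc m *\<^sub>R ((\<alpha> * real (Suc m)) *\<^sub>R c (Suc m))) sums ((\<alpha> * w) *\<^sub>R D)"
      by (simp add: diffs_def scaleR_conv_of_real mult_ac)
    then have "(\<lambda>m. w ^ m *\<^sub>R ((\<alpha> * real m) *\<^sub>R c m)) sums ((\<alpha> * w) *\<^sub>R D)"
      by (subst (asm) sums_Suc_iff) simp
    then have "alpha_series \<alpha> (\<lambda>m. (\<alpha> * real m) *\<^sub>R c m) t = (\<alpha> * w) *\<^sub>R D"
      unfolding alpha_series_def w_def by (simp add: sums_iff)
    moreover have "t powr (\<alpha> - 1) = w / t"
      using assms by (simp add: w_def powr_diff)
    ultimately show ?thesis by simp
  qed
  ultimately show ?thesis by simp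
qed

text \<open>Serves the endpoint, where the formula with \<open>1 / t\<close> says nothing: once for
  the right derivative at 0 and once for the identity theorem.\<close>

lemma alpha_series_tendsto_0:
  fixes c :: "nat \<Rightarrow> 'a::{real_normed_field,banach}"
  assumes "\<alpha> > 0" "norm_conv \<alpha> \<rho> c" "\<rho> > 0"
  shows "(alpha_series \<alpha> c \<longlongrightarrow> c 0) (at 0 within {0..})"
proof -
  have "0 \<in> right_open_ivl \<rho>" using assms by (simp add: right_open_ivl_def zero_ereal_def)
  then obtain t' where t': "t' \<in> right_open_ivl \<rho>" "0 < t'"
    by (rule right_open_ivl_larger)
  have sm: "summable (\<lambda>m. c m * (of_real (t' powr \<alpha>)) ^ m)"
    using norm_conv_series[OF assms(1,2) t'(1)]
    by (simp add: scaleR_conv_of_real mult.commute sums_iff)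
  have "((\<lambda>x. x powr \<alpha>) \<longlongrightarrow> 0) (at (0::real) within {0..})"
    using assms(1) by (intro tendsto_zero_powrI[where b = \<alpha>])
      (auto simp: eventually_at_filter intro!: tendsto_eq_intros)
  then have "((\<lambda>x. \<Sum>m. c m * (of_real (x powr \<alpha>)) ^ m) \<longlongrightarrow> (\<Sum>m. c m * (of_real 0) ^ m))
      (at (0::real) within {0..})"
    using t'(2)
    by (intro isCont_tendsto_compose[OF isCont_powser[OF sm]] tendsto_of_real) auto
  then show ?thesis
    by (simp add: alpha_series_def[abs_def] scaleR_conv_of_real mult.commute)
qed

text \<open>For \<open>t > 0\<close> the product rule yields the weight
  \<open>\<alpha> * m + s\<close>, which is the exponent of the \<open>m\<close>-th term. At
  \<open>t = 0\<close> the difference quotient is \<open>x powr (s - 1)\<close> times the series;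
  its limit is \<open>c 0\<close> for \<open>s = 1\<close> and 0 for \<open>s > 1\<close>, in
  agreement with the convention that the prefactor of exponent 0 is 1.\<close>

lemma has_vector_derivative_shifted_series:
  fixes c :: "nat \<Rightarrow> 'a::{real_normed_field,banach}"
  assumes "\<alpha> > 0" "norm_conv \<alpha> \<rho> c" "t \<in> right_open_ivl \<rho>" "s \<ge> 1"
  shows "(shifted_series \<alpha> s c has_vector_derivative
     shifted_series \<alpha> (s - 1) (\<lambda>m. (\<alpha> * real m + s) *\<^sub>R c m) t) (at t within {0..})"
proof (cases "t = 0")
  case False
  then have t: "t > 0" using assms right_open_ivl_nonneg[OF assms(3)] by simp
  let ?d = "\<lambda>m. (\<alpha> * real m) *\<^sub>R c m"
  have cd: "norm_conv \<alpha> \<rho> ?d" using norm_conv_affine_mult[OF assms(1,2), of 0] by simp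
  have "((\<lambda>x. x powr s) has_field_derivative (s * t powr (s - 1))) (at t within {0..})"
    using t by (auto intro!: derivative_eq_intros)
  then have "((\<lambda>x. x powr s *\<^sub>R alpha_series \<alpha> c x) has_vector_derivative
      (t powr s *\<^sub>R ((1 / t) *\<^sub>R alpha_series \<alpha> ?d t) + (s * t powr (s - 1)) *\<^sub>R alpha_series \<alpha> c t))
      (at t within {0..})"
    by (intro has_vector_derivative_scaleR has_vector_derivative_alpha_series[OF assms(1-3) t])
  moreover have "alpha_series \<alpha> (\<lambda>m. (\<alpha> * real m + s) *\<^sub>R c m) t
      = alpha_series \<alpha> ?d t + s *\<^sub>R alpha_series \<alpha> c t"
  proof -
    have "(\<lambda>m. (t powr \<alpha>) ^ m *\<^sub>R ?d m + s *\<^sub>R ((t powr \<alpha>) ^ m *\<^sub>R c m)) sums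
       (alpha_series \<alpha> ?d t + s *\<^sub>R alpha_series \<alpha> c t)"
      by (intro sums_add sums_scaleR_right norm_conv_series[OF assms(1) _ assms(3)] cd assms)
    moreover have "(\<lambda>m. (t powr \<alpha>) ^ m *\<^sub>R ?d m + s *\<^sub>R ((t powr \<alpha>) ^ m *\<^sub>R c m)) =
      (\<lambda>m. (t powr \<alpha>) ^ m *\<^sub>R ((\<alpha> * real m + s) *\<^sub>R c m))"
      by (auto simp: algebra_simps)
    ultimately have "(\<lambda>m. (t powr \<alpha>) ^ m *\<^sub>R ((\<alpha> * real m + s) *\<^sub>R c m)) sums
       (alpha_series \<alpha> ?d t + s *\<^sub>R alpha_series \<alpha> c t)"
      by (simp only:)
    then show ?thesis
      unfolding alpha_series_def[of _ "\<lambda>m. (\<alpha> * real m + s) *\<^sub>R c m"] by (rule sums_unique[symmetric])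
  qed
  moreover have "t powr s = t * t powr (s - 1)" using t by (simp add: powr_diff)
  ultimately show ?thesis using assms t
    by (auto simp: shifted_series_def[abs_def] scaleR_add_right mult.commute)
next
  case True
  from assms(3) have \<rho>: "\<rho> > 0"
    using True by (simp add: right_open_ivl_def zero_ereal_def)
  have *: "((\<lambda>x. (if s = 1 then 1 else x powr (s - 1)) *\<^sub>R alpha_series \<alpha> c x) \<longlongrightarrow>
      (if s = 1 then 1 else 0) *\<^sub>R c 0) (at 0 within {0..})"
  proof (intro tendsto_scaleR alpha_series_tendsto_0[OF assms(1,2) \<rho>])
    show "((\<lambda>x. if s = 1 then 1 else x powr (s - 1)) \<longlongrightarrow> (if s = 1 then 1 else 0))
        (at (0::real) within {0..})"
      using assms(4) by (auto intro!: tendsto_zero_powrI[where b = "s - 1"]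
          tendsto_eq_intros simp: eventually_at_filter)
  qed
  have "(shifted_series \<alpha> s c has_vector_derivative
     (if s = 1 then 1 else 0) *\<^sub>R c 0) (at 0 within {0..})"
    unfolding has_vector_derivative_def has_derivative_within
  proof (intro conjI bounded_linear_scaleR_left)
    let ?L = "(if s = 1 then 1 else 0) *\<^sub>R c 0"
    show "((\<lambda>y. (1 / norm (y - 0)) *\<^sub>R (shifted_series \<alpha> s c y - (shifted_series \<alpha> s c 0 + (y - 0) *\<^sub>R ?L)))
        \<longlongrightarrow> 0) (at 0 within {0..})"
    proof (rule Lim_transform_eventually[OF LIM_zero[OF *]])
      show "\<forall>\<^sub>F x in at 0 within {0..}. (if s = 1 then 1 else x powr (s - 1)) *\<^sub>R alpha_series \<alpha> c x - ?L =
        (1 / norm (x - 0)) *\<^sub>R (shifted_series \<alpha> s c x - (shifted_series \<alpha> s c 0 + (x - 0) *\<^sub>R ?L))"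
        unfolding eventually_at_filter
        using assms(4) by (intro always_eventually)
          (auto simp: shifted_series_def powr_diff scaleR_diff_right)
    qed
  qed
  then show ?thesis using True assms by (auto simp: shifted_series_def)
qed

text \<open>Passes from the relational derivative to the chosen one: \<open>t\<close> is a limit
  point of \<open>{0..}\<close>, so the derivative is unique, and all points of \<open>{0..}\<close>
  near \<open>t\<close> lie in the interval, so agreement there suffices.\<close>

lemma half_line_deriv_eqI:
  assumes "(f has_vector_derivative D) (at t within {0..})" "t \<in> right_open_ivl \<rho>"
    and "\<And>x. x \<in> right_open_ivl \<rho> \<Longrightarrow> g x = f x"
  shows "half_line_deriv g t = D"
proof -
  obtain t' where t': "t' \<in> right_open_ivl \<rho>" "t < t'" 
    using assms(2) by (rule right_open_ivl_larger)
  have "(g has_vector_derivative D) (at t within {0..})"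
  proof (rule has_vector_derivative_transform_within[OF assms(1), of "t' - t"])
    show "f x = g x" if "x \<in> {0..}" "dist x t < t' - t" for x
      using that t' by (intro assms(3)[symmetric] right_open_ivl_downward[OF t'(1)])
        (auto simp: dist_real_def)
  qed (use t' assms(2) in \<open>auto simp: right_open_ivl_def\<close>)
  moreover have "at t within {0..} \<noteq> bot"
    using islimpt_subset[of t "{t..t+1}" "{0..}"] islimpt_Icc[of t "t+1"] right_open_ivl_nonneg[OF assms(2)]
    by (simp add: trivial_limit_within)
  ultimately show ?thesis unfolding half_line_deriv_def by (intro vector_derivative_within)
qed

text \<open>The accumulated weight is the falling factorial of the exponent
  \<open>\<alpha> * m + s\<close>. The bound \<open>real k \<le> s\<close> ensures that before each
  differentiation the prefactor exponent is still at least 1. Convergence is part of the induction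
  because the next derivative needs it for the current coefficients.\<close>

lemma half_line_deriv_funpow_shifted_series:
  fixes c :: "nat \<Rightarrow> 'a::{real_normed_field,banach}"
  assumes "\<alpha> > 0" "norm_conv \<alpha> \<rho> c" "real k \<le> s"
    and "\<And>t. t \<in> right_open_ivl \<rho> \<Longrightarrow> f t = shifted_series \<alpha> s c t"
  shows "norm_conv \<alpha> \<rho> (\<lambda>m. (\<Prod>j<k. \<alpha> * real m + s - real j) *\<^sub>R c m) \<and>
    (\<forall>t \<in> right_open_ivl \<rho>. (half_line_deriv ^^ k) f t =
     shifted_series \<alpha> (s - real k) (\<lambda>m. (\<Prod>j<k. \<alpha> * real m + s - real j) *\<^sub>R c m) t)"
  using assms(3)
proof (induction k)
  case 0
  then show ?case by (simp add: assms(2,4))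
next
  case (Suc k)
  let ?d = "\<lambda>k m. (\<Prod>j<k. \<alpha> * real m + s - real j) *\<^sub>R c m"
  have IH: "norm_conv \<alpha> \<rho> (?d k)"
    "\<And>t. t \<in> right_open_ivl \<rho> \<Longrightarrow> (half_line_deriv ^^ k) f t = shifted_series \<alpha> (s - real k) (?d k) t"
    using Suc.IH Suc.prems by simp_all
  have eq: "?d (Suc k) = (\<lambda>m. (\<alpha> * real m + (s - real k)) *\<^sub>R ?d k m)"
    by (simp add: add_diff_eq mult.commute)
  have conv: "norm_conv \<alpha> \<rho> (?d (Suc k))"
    unfolding eq by (rule norm_conv_affine_mult[OF assms(1) IH(1)])
  moreover have "(half_line_deriv ^^ Suc k) f t = shifted_series \<alpha> (s - real (Suc k)) (?d (Suc k)) t"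
    if t: "t \<in> right_open_ivl \<rho>" for t
  proof -
    have "half_line_deriv ((half_line_deriv ^^ k) f) t
        = shifted_series \<alpha> ((s - real k) - 1) (\<lambda>m. (\<alpha> * real m + (s - real k)) *\<^sub>R ?d k m) t"
      using Suc.prems
      by (intro half_line_deriv_eqI[OF has_vector_derivative_shifted_series[OF assms(1) IH(1) t] t IH(2)])
        auto
    then show ?thesis unfolding eq by (simp add: diff_diff_eq add.commute)
  qed
  ultimately show ?case by blast
qed

section \<open>Termwise fractional integration and the Caputo derivative\<close>

text \<open>The scalar type is not assumed second countable, so neither Bochner integration nor dominated
  convergence is available for the singular kernel; this works directly with gauges.\<close>

lemma has_integral_weighted_uniform_limit:
  fixes f :: "nat \<Rightarrow> real \<Rightarrow> 'b::real_normed_vector"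
  assumes f: "\<And>n. (f n has_integral I n) {a..b}" and k: "(k has_integral K) {a..b}"
    and le: "\<And>n x. x \<in> {a..b} \<Longrightarrow> norm (f n x - g x) \<le> e n * k x"
    and e: "e \<longlonglongrightarrow> 0" "\<And>n. 0 \<le> e n" and I: "I \<longlonglongrightarrow> J"
  shows "(g has_integral J) {a..b}"
  unfolding has_integral_real
proof (intro allI impI)
  fix \<epsilon> :: real assume \<epsilon>: "\<epsilon> > 0"
  have "(\<lambda>n. e n * (\<bar>K\<bar> + 1)) \<longlonglongrightarrow> 0" using e by (intro tendsto_mult_left_zero)
  from order_tendstoD(2)[OF this, of "\<epsilon> / 3"] \<epsilon>
  have "eventually (\<lambda>n. e n * (\<bar>K\<bar> + 1) < \<epsilon> / 3) sequentially" by simp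
  moreover have "eventually (\<lambda>n. dist (I n) J < \<epsilon> / 3) sequentially"
    using I \<epsilon> by (intro tendstoD) auto
  ultimately have "eventually (\<lambda>n. e n * (\<bar>K\<bar> + 1) < \<epsilon> / 3 \<and> dist (I n) J < \<epsilon> / 3) sequentially"
    by (rule eventually_conj)
  then obtain n where n: "e n * (\<bar>K\<bar> + 1) < \<epsilon> / 3" "norm (I n - J) < \<epsilon> / 3"
    using eventually_happens'[OF sequentially_bot] by (auto simp: dist_norm)
  have "\<exists>\<gamma>. gauge \<gamma> \<and> (\<forall>D. D tagged_division_of {a..b} \<and> \<gamma> fine D \<longrightarrow>
      norm ((\<Sum>(x,X)\<in>D. measure lborel X *\<^sub>R f n x) - I n) < \<epsilon> / 3)"
    by (rule mp[OF spec[OF f[of n, unfolded has_integral_real], of "\<epsilon> / 3"]]) (use \<epsilon> in simp)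
  then obtain \<gamma>1 where \<gamma>1: "gauge \<gamma>1" "\<forall>D. D tagged_division_of {a..b} \<and> \<gamma>1 fine D \<longrightarrow>
      norm ((\<Sum>(x,X)\<in>D. measure lborel X *\<^sub>R f n x) - I n) < \<epsilon> / 3"
    by (elim exE conjE) (rule that)
  \<comment> \<open>A second gauge keeps the Riemann sums of the weight \<open>k\<close> below
    \<open>\<bar>K\<bar> + 1\<close>. Through the pointwise bound this makes the Riemann sums of
    \<open>f n\<close> and \<open>g\<close> close for every fine division.\<close>
  have "\<exists>\<gamma>. gauge \<gamma> \<and> (\<forall>D. D tagged_division_of {a..b} \<and> \<gamma> fine D \<longrightarrow>
      norm ((\<Sum>(x,X)\<in>D. measure lborel X *\<^sub>R k x) - K) < 1)"
    by (rule mp[OF spec[OF k[unfolded has_integral_real], of 1]]) simp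
  then obtain \<gamma>2 where \<gamma>2: "gauge \<gamma>2" "\<forall>D. D tagged_division_of {a..b} \<and> \<gamma>2 fine D \<longrightarrow>
      norm ((\<Sum>(x,X)\<in>D. measure lborel X *\<^sub>R k x) - K) < 1"
    by (elim exE conjE) (rule that)
  show "\<exists>\<gamma>. gauge \<gamma> \<and> (\<forall>D. D tagged_division_of {a..b} \<and> \<gamma> fine D \<longrightarrow>
      norm ((\<Sum>(x,k)\<in>D. measure lborel k *\<^sub>R g x) - J) < \<epsilon>)"
  proof (intro exI[of _ "\<lambda>x. \<gamma>1 x \<inter> \<gamma>2 x"] conjI allI impI)
    show "gauge (\<lambda>x. \<gamma>1 x \<inter> \<gamma>2 x)" using \<gamma>1 \<gamma>2 by (intro gauge_Int)
    fix D assume D: "D tagged_division_of {a..b} \<and> (\<lambda>x. \<gamma>1 x \<inter> \<gamma>2 x) fine D"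
    then have fine: "\<gamma>1 fine D" "\<gamma>2 fine D" by (auto simp: fine_Int)
    let ?S = "\<lambda>h. \<Sum>(x,X)\<in>D. measure lborel X *\<^sub>R h x"
    have "norm (?S (f n) - ?S g) = norm (\<Sum>(x,X)\<in>D. measure lborel X *\<^sub>R (f n x - g x))"
      by (simp add: sum_subtractf[symmetric] case_prod_unfold scaleR_diff_right)
    also have "\<dots> \<le> (\<Sum>(x,X)\<in>D. e n * (measure lborel X * k x))"
    proof (rule sum_norm_le, clarify)
      fix x X assume "(x, X) \<in> D"
      then have "x \<in> {a..b}" using D by (meson subsetD tagged_division_ofD(2,3))
      from mult_left_mono[OF le[OF this], of "measure lborel X" n]
      show "norm (measure lborel X *\<^sub>R (f n x - g x)) \<le> e n * (measure lborel X * k x)"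
        by (simp add: mult_ac)
    qed
    also have "\<dots> = e n * (\<Sum>(x,X)\<in>D. measure lborel X *\<^sub>R k x)"
      by (simp add: sum_distrib_left case_prod_unfold)
    also have "\<dots> \<le> e n * (\<bar>K\<bar> + 1)"
    proof (intro mult_left_mono e(2))
      have "norm ((\<Sum>(x,X)\<in>D. measure lborel X *\<^sub>R k x) - K) < 1"
        using D fine by (intro mp[OF spec[OF \<gamma>2(2)]]) simp
      then show "(\<Sum>(x,X)\<in>D. measure lborel X *\<^sub>R k x) \<le> \<bar>K\<bar> + 1"
        unfolding real_norm_def by linarith
    qed
    also note n(1)
    finally have "norm (?S (f n) - ?S g) < \<epsilon> / 3" .
    moreover have "norm (?S (f n) - I n) < \<epsilon> / 3" 
      using D fine by (intro mp[OF spec[OF \<gamma>1(2)]]) simp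
    moreover have "norm (?S g - J) \<le> norm (?S (f n) - I n) + norm (?S (f n) - ?S g) + norm (I n - J)"
      using norm_triangle_ineq[of "(?S (f n) - I n) - (?S (f n) - ?S g)" "I n - J"]
        norm_triangle_ineq4[of "?S (f n) - I n" "?S (f n) - ?S g"] by simp
    ultimately show "norm (?S g - J) < \<epsilon>" using n(2) by linarith
  qed
qed

text \<open>The substitution \<open>t = x * s\<close> reduces this to Euler's Beta integral; the
  exponent \<open>a + b\<close> collects \<open>a\<close> from the power, \<open>b - 1\<close> from
  the kernel and 1 from the differential.\<close>

lemma has_integral_Beta_scaled:
  fixes a b x :: real
  assumes "x > 0" "a > -1" "b > 0"
  shows "((\<lambda>t. (x - t) powr (b - 1) * t powr a) has_integral (x powr (a + b) * Beta (a + 1) b)) {0..x}"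
proof -
  have "((\<lambda>t. t powr a * (1 - t) powr (b - 1)) has_integral Beta (a + 1) b) {0..1}"
    using has_integral_Beta_real[of "a + 1" b] assms by simp
  from has_integral_stretch_real[OF this, of "1 / x"] assms
  have "((\<lambda>t. (t / x) powr a * (1 - t / x) powr (b - 1)) has_integral (x * Beta (a + 1) b))
      ((\<lambda>t. t * x) ` {0..1})"
    by simp
  also have "(\<lambda>t. t * x) ` {0..1} = {0..x}" 
    using assms image_mult_atLeastAtMost[of x 0 1] by (simp add: mult.commute[of _ x])
  finally have "((\<lambda>t. x powr (a + b - 1) * ((t / x) powr a * (1 - t / x) powr (b - 1))) has_integral
      (x powr (a + b - 1) * (x * Beta (a + 1) b))) {0..x}"
    by (rule has_integral_mult_right)
  moreover have "x powr (a + b - 1) * (x * Beta (a + 1) b) = x powr (a + b) * Beta (a + 1) b"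
    using assms by (simp add: powr_diff)
  moreover have "x powr (a + b - 1) * ((t / x) powr a * (1 - t / x) powr (b - 1))
      = (x - t) powr (b - 1) * t powr a" if "t \<in> {0..x}" for t
  proof -
    have "1 - t / x = (x - t) / x" using assms by (simp add: field_simps)
    then have "(t / x) powr a * (1 - t / x) powr (b - 1)
        = (t powr a / x powr a) * ((x - t) powr (b - 1) / x powr (b - 1))"
      using that assms by (simp add: powr_divide)
    moreover have "x powr (a + b - 1) = x powr a * x powr (b - 1)"
      by (simp add: powr_add[symmetric] algebra_simps)
    ultimately show ?thesis using assms by simp
  qed
  ultimately show ?thesis by (metis (no_types, lifting) has_integral_cong)
qed

text \<open>Restricted to successors because the analogue with exponent 0 fails at
  \<open>t = 0\<close>, where \<open>0 powr 0 = 0\<close> but \<open>0 ^ 0 = 1\<close>.\<close>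

lemma powr_mult_Suc:
  fixes t \<alpha> :: real
  shows "t powr (\<alpha> * real (Suc m)) = t powr \<alpha> * (t powr \<alpha>) ^ m"
proof (induction m)
  case (Suc m)
  have "\<alpha> * real (Suc (Suc m)) = \<alpha> * real (Suc m) + \<alpha>" by (simp add: algebra_simps)
  then show ?case by (simp only: powr_add Suc power_Suc mult_ac)
qed simp

lemma Beta_real_nonneg: "a > 0 \<Longrightarrow> b > 0 \<Longrightarrow> 0 \<le> Beta a (b::real)"
  by (simp add: Beta_def Gamma_real_pos less_imp_le)

text \<open>Each term is a Beta integral, which gives the Gamma quotient. Sum and integral may be
  interchanged because, after factoring out \<open>t powr \<alpha>\<close>, the partial sums
  converge uniformly on \<open>{0..x}\<close>, while the remaining weight
  \<open>(x - t) powr (\<beta> - 1) * t powr \<alpha>\<close> is integrable. The case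
  \<open>\<beta> = 0\<close>, where the integral is the identity by definition, arises for integer
  \<alpha>.\<close>

lemma frac_integral_shifted_series:
  fixes c :: "nat \<Rightarrow> 'a::{real_normed_field,banach}"
  assumes "\<alpha> > 0" "norm_conv \<alpha> \<rho> c" "\<beta> \<ge> 0"
    and \<phi>: "\<And>t. t \<in> right_open_ivl \<rho> \<Longrightarrow> \<phi> t = shifted_series \<alpha> \<alpha> c t"
  defines "d \<equiv> \<lambda>m. (Gamma (\<alpha> * real (Suc m) + 1) / Gamma (\<alpha> * real (Suc m) + 1 + \<beta>)) *\<^sub>R c m"
  shows "norm_conv \<alpha> \<rho> d \<and>
    (\<forall>x \<in> right_open_ivl \<rho>. frac_integral \<beta> \<phi> x = shifted_series \<alpha> (\<alpha> + \<beta>) d x)"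
proof (cases "\<beta> = 0")
  case True
  have "\<alpha> * real (Suc m) + 1 > 0" for m using assms(1) by (intro add_nonneg_pos) auto
  then have "Gamma (\<alpha> * real (Suc m) + 1) \<noteq> 0" for m
    using Gamma_real_pos by (metis less_irrefl)
  then have "d = c" using True by (auto simp: d_def)
  then show ?thesis using True assms(2) \<phi> by (simp add: frac_integral_def)
next
  case False
  then have \<beta>: "\<beta> > 0" using assms by simp
  define B where "B = (\<lambda>m. Beta (\<alpha> * real (Suc m) + 1) \<beta>)"
  have pos: "\<alpha> * real (Suc m) > 0" for m using assms(1) by simp
  have gt: "\<alpha> * real (Suc m) > - 1" for m using pos[of m] by linarith
  \<comment> \<open>The Beta function decreases in its first argument, here at least 1, so these
    weights are bounded and cannot harm convergence.\<close>
  have "\<bar>B m\<bar> \<le> Beta 1 \<beta>" for m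
    unfolding B_def using pos[of m] \<beta>
    by (subst abs_of_nonneg) (auto intro!: Beta_real_nonneg Beta_real_mono)
  then have conv: "norm_conv \<alpha> \<rho> (\<lambda>m. B m *\<^sub>R c m)"
    by (rule norm_conv_bounded_mult[OF assms(2)])
  have G: "Gamma \<beta> > 0" using \<beta> by (rule Gamma_real_pos)
  have d: "d = (\<lambda>m. (1 / Gamma \<beta>) *\<^sub>R (B m *\<^sub>R c m))"
    using G by (simp add: d_def B_def Beta_def)
  have convd: "norm_conv \<alpha> \<rho> d"
    unfolding d by (rule norm_conv_bounded_mult[OF conv order_refl])
  moreover have "frac_integral \<beta> \<phi> x = shifted_series \<alpha> (\<alpha> + \<beta>) d x"
    if x: "x \<in> right_open_ivl \<rho>" for x
  proof (cases "x = 0")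
    case True
    then show ?thesis using \<beta> assms(1) by (simp add: frac_integral_def shifted_series_def)
  next
    case False
    then have xpos: "x > 0" using right_open_ivl_nonneg[OF x] by simp
    have xin: "t \<in> right_open_ivl \<rho>" if "t \<in> {0..x}" for t
      using right_open_ivl_downward[OF x] that by auto
    \<comment> \<open>The tail of the absolute series at the right endpoint \<open>x\<close>; it
      dominates the tails at all \<open>t \<le> x\<close> because
      \<open>t powr \<alpha> \<le> x powr \<alpha>\<close>.\<close>
    define e where "e = (\<lambda>n. \<Sum>m. norm (c (m + n)) * (x powr \<alpha>) ^ (m + n))"
    have sx: "summable (\<lambda>m. norm (c m) * (x powr \<alpha>) ^ m)"
      using assms(2) x by (simp add: norm_conv_def)
    have "((\<lambda>t. (x - t) powr (\<beta> - 1) *\<^sub>R \<phi> t) has_integral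
        x powr (\<alpha> + \<beta>) *\<^sub>R alpha_series \<alpha> (\<lambda>m. B m *\<^sub>R c m) x) {0..x}"
    proof (rule has_integral_weighted_uniform_limit)
      show "((\<lambda>t. \<Sum>m<n. ((x - t) powr (\<beta> - 1) * t powr (\<alpha> * real (Suc m))) *\<^sub>R c m) has_integral
          (\<Sum>m<n. (x powr (\<alpha> * real (Suc m) + \<beta>) * B m) *\<^sub>R c m)) {0..x}" for n
        unfolding B_def
        by (intro has_integral_sum has_integral_scaleR_left has_integral_Beta_scaled xpos \<beta> gt) simp
      show "((\<lambda>t. (x - t) powr (\<beta> - 1) * t powr \<alpha>) has_integral
          x powr (\<alpha> + \<beta>) * Beta (\<alpha> + 1) \<beta>) {0..x}"
        using xpos \<beta> assms(1) by (intro has_integral_Beta_scaled) auto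
      show "e \<longlonglongrightarrow> 0" unfolding e_def by (rule suminf_exist_split2[OF sx])
      show "0 \<le> e n" for n
        unfolding e_def by (intro suminf_nonneg summable_ignore_initial_segment[OF sx]) auto
      show "norm ((\<Sum>m<n. ((x - t) powr (\<beta> - 1) * t powr (\<alpha> * real (Suc m))) *\<^sub>R c m)
          - (x - t) powr (\<beta> - 1) *\<^sub>R \<phi> t) \<le> e n * ((x - t) powr (\<beta> - 1) * t powr \<alpha>)"
        if t: "t \<in> {0..x}" for n t
      proof -
        let ?q = "t powr \<alpha>" and ?k = "(x - t) powr (\<beta> - 1)"
        have qx: "?q \<le> x powr \<alpha>" using t assms(1) by (intro powr_mono2) auto
        have sm: "(\<lambda>m. ?q ^ m *\<^sub>R c m) sums alpha_series \<alpha> c t"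
          by (rule norm_conv_series[OF assms(1,2) xin[OF t]])
        have "\<phi> t = ?q *\<^sub>R alpha_series \<alpha> c t"
          using \<phi>[OF xin[OF t]] assms(1) by (simp add: shifted_series_def)
        moreover have "alpha_series \<alpha> c t = (\<Sum>m. ?q ^ (m + n) *\<^sub>R c (m + n)) + (\<Sum>m<n. ?q ^ m *\<^sub>R c m)"
          using suminf_split_initial_segment[OF sums_summable[OF sm], of n] sm by (simp add: sums_iff)
        moreover have "(\<Sum>m<n. (?k * t powr (\<alpha> * real (Suc m))) *\<^sub>R c m)
            = (?k * ?q) *\<^sub>R (\<Sum>m<n. ?q ^ m *\<^sub>R c m)"
          by (simp only: powr_mult_Suc scaleR_sum_right scaleR_scaleR mult.assoc)
        ultimately have "(\<Sum>m<n. (?k * t powr (\<alpha> * real (Suc m))) *\<^sub>R c m) - ?k *\<^sub>R \<phi> t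
            = - ((?k * ?q) *\<^sub>R (\<Sum>m. ?q ^ (m + n) *\<^sub>R c (m + n)))"
          by (simp add: algebra_simps)
        then have "norm ((\<Sum>m<n. (?k * t powr (\<alpha> * real (Suc m))) *\<^sub>R c m) - ?k *\<^sub>R \<phi> t)
            = (?k * ?q) * norm (\<Sum>m. ?q ^ (m + n) *\<^sub>R c (m + n))"
          by simp
        also have "\<dots> \<le> (?k * ?q) * e n"
        proof (rule mult_left_mono)
          show "norm (\<Sum>m. ?q ^ (m + n) *\<^sub>R c (m + n)) \<le> e n"
            unfolding e_def
          proof (rule norm_suminf_le)
            show "norm (?q ^ (m + n) *\<^sub>R c (m + n)) \<le> norm (c (m + n)) * (x powr \<alpha>) ^ (m + n)" for m
              using qx by (simp add: mult.commute mult_left_mono power_mono)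
            show "summable (\<lambda>m. norm (c (m + n)) * (x powr \<alpha>) ^ (m + n))"
              by (rule summable_ignore_initial_segment[OF sx])
          qed
        qed simp
        finally show ?thesis by (simp only: mult.commute)
      qed
      have "x powr (\<alpha> * real (Suc m) + \<beta>) * B m = x powr (\<alpha> + \<beta>) * ((x powr \<alpha>) ^ m * B m)" for m
        by (simp only: powr_add powr_mult_Suc mult_ac)
      then have "(\<lambda>n. \<Sum>m<n. (x powr (\<alpha> * real (Suc m) + \<beta>) * B m) *\<^sub>R c m) =
         (\<lambda>n. x powr (\<alpha> + \<beta>) *\<^sub>R (\<Sum>m<n. (x powr \<alpha>) ^ m *\<^sub>R (B m *\<^sub>R c m)))"
        by (simp only: scaleR_sum_right scaleR_scaleR)
      then show "(\<lambda>n. \<Sum>m<n. (x powr (\<alpha> * real (Suc m) + \<beta>) * B m) *\<^sub>R c m) \<longlonglongrightarrow>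
          x powr (\<alpha> + \<beta>) *\<^sub>R alpha_series \<alpha> (\<lambda>m. B m *\<^sub>R c m) x"
        using norm_conv_series[OF assms(1) conv x, unfolded sums_def]
        by (simp only: tendsto_scaleR[OF tendsto_const])
    qed
    then have "integral {0..x} (\<lambda>t. (x - t) powr (\<beta> - 1) *\<^sub>R \<phi> t)
        = x powr (\<alpha> + \<beta>) *\<^sub>R alpha_series \<alpha> (\<lambda>m. B m *\<^sub>R c m) x"
      by (rule integral_unique)
    moreover have "alpha_series \<alpha> d x = (1 / Gamma \<beta>) *\<^sub>R alpha_series \<alpha> (\<lambda>m. B m *\<^sub>R c m) x"
    proof -
      have "(\<lambda>m. (1 / Gamma \<beta>) *\<^sub>R ((x powr \<alpha>) ^ m *\<^sub>R (B m *\<^sub>R c m))) sums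
          ((1 / Gamma \<beta>) *\<^sub>R alpha_series \<alpha> (\<lambda>m. B m *\<^sub>R c m) x)"
        by (intro sums_scaleR_right norm_conv_series[OF assms(1) conv x])
      then have "(\<lambda>m. (x powr \<alpha>) ^ m *\<^sub>R d m) sums
          ((1 / Gamma \<beta>) *\<^sub>R alpha_series \<alpha> (\<lambda>m. B m *\<^sub>R c m) x)"
        by (simp add: d mult_ac)
      then show ?thesis unfolding alpha_series_def[of _ d] by (rule sums_unique[symmetric])
    qed
    ultimately show ?thesis
      using \<beta> assms(1) by (simp add: frac_integral_def shifted_series_def mult.commute)
  qed
  ultimately show ?thesis by blast
qed

section \<open>The Caputo derivative on coefficients\<close>

definition caputo_coeffs :: "real \<Rightarrow> (nat \<Rightarrow> 'a::real_normed_vector) \<Rightarrow> nat \<Rightarrow> 'a" where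
  "caputo_coeffs \<alpha> c m =
     (Gamma (\<alpha> * real (Suc m) + 1) / Gamma (\<alpha> * real m + 1)) *\<^sub>R c (Suc m)"

lemma frac_order_bounds:
  assumes "\<alpha> > 0"
  shows "frac_order \<alpha> \<ge> 1" "\<alpha> \<le> real (frac_order \<alpha>)" "real (frac_order \<alpha>) - 1 < \<alpha>"
proof -
  have "real (frac_order \<alpha>) = of_int \<lceil>\<alpha>\<rceil>" using assms by (simp add: frac_order_def)
  then show "\<alpha> \<le> real (frac_order \<alpha>)" "real (frac_order \<alpha>) - 1 < \<alpha>" by linarith+
  with assms show "frac_order \<alpha> \<ge> 1" by (cases "frac_order \<alpha>") auto
qed

text \<open>A falling factorial from \<open>x + l\<close> read backwards is a rising one from
  \<open>x + 1\<close>, and for the latter the Gamma quotient is known.\<close>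

lemma prod_descending_eq_pochhammer:
  fixes x :: real
  shows "(\<Prod>j<l. x + real l - real j) = pochhammer (x + 1) l"
proof (induction l)
  case (Suc l)
  have "(\<Prod>j<Suc l. x + real (Suc l) - real j) = (x + real (Suc l)) * (\<Prod>j<l. x + real l - real j)"
    by (subst prod.lessThan_Suc_shift) (simp add: add_diff_eq add_ac)
  also have "\<dots> = pochhammer (x + 1) (Suc l)" using Suc by (simp add: pochhammer_Suc add_ac mult.commute)
  finally show ?case .
qed simp

text \<open>The first derivative kills the constant term and fits the rest into prefactor form.
  After all \<open>k\<close> derivatives the prefactor exponent is \<open>\<alpha> - k\<close>,
  strictly positive, so the value at 0 vanishes.\<close>

lemma half_line_deriv_funpow_zero:
  fixes c :: "nat \<Rightarrow> 'a::{real_normed_field,banach}"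
  assumes "\<alpha> > 0" "norm_conv \<alpha> \<rho> c" "\<rho> > 0" "k \<ge> 1" "real k < \<alpha>"
    and u: "\<And>t. t \<in> right_open_ivl \<rho> \<Longrightarrow> u t = alpha_series \<alpha> c t"
  shows "(half_line_deriv ^^ k) u 0 = 0"
proof -
  let ?c = "\<lambda>m. c (Suc m)"
  have conv: "norm_conv \<alpha> \<rho> ?c" by (rule norm_conv_Suc[OF assms(1,2)])
  obtain j where j: "k = Suc j" using assms(4) by (cases k) auto
  have z: "0 \<in> right_open_ivl \<rho>" using assms by (simp add: right_open_ivl_def zero_ereal_def)
  have "half_line_deriv u t = shifted_series \<alpha> (\<alpha> - 1) (\<lambda>m. (\<alpha> * real m + \<alpha>) *\<^sub>R ?c m) t"
    if t: "t \<in> right_open_ivl \<rho>" for t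
  proof (rule half_line_deriv_eqI[OF _ t])
    have "((\<lambda>t. c 0 + shifted_series \<alpha> \<alpha> ?c t) has_vector_derivative
        0 + shifted_series \<alpha> (\<alpha> - 1) (\<lambda>m. (\<alpha> * real m + \<alpha>) *\<^sub>R ?c m) t) (at t within {0..})"
      using assms(4,5)
      by (intro has_vector_derivative_add has_vector_derivative_const
          has_vector_derivative_shifted_series[OF assms(1) conv t]) simp
    then show "((\<lambda>t. c 0 + shifted_series \<alpha> \<alpha> ?c t) has_vector_derivative
        shifted_series \<alpha> (\<alpha> - 1) (\<lambda>m. (\<alpha> * real m + \<alpha>) *\<^sub>R ?c m) t) (at t within {0..})"
      by simp
    show "u x = c 0 + shifted_series \<alpha> \<alpha> ?c x" if "x \<in> right_open_ivl \<rho>" for x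
      using u[OF that] alpha_series_split[OF assms(1,2) that] by simp
  qed
  from half_line_deriv_funpow_shifted_series[OF assms(1) norm_conv_affine_mult[OF assms(1) conv] _ this,
      of j] assms(5) z
  have "(half_line_deriv ^^ j) (half_line_deriv u) 0 = 0"
    by (simp add: j shifted_series_def)
  then show ?thesis by (simp add: j funpow_swap1)
qed

text \<open>The fractional integral produces the prefactor exponent
  \<open>\<alpha> + (l - \<alpha>) = l\<close>, which the \<open>l\<close> derivatives use up
  exactly. They end at exponent 0, where the prefactor is 1 by convention, so a plain series remains
  even at \<open>t = 0\<close>.\<close>

lemma caputo_deriv_alpha_series:
  fixes c :: "nat \<Rightarrow> 'a::{real_normed_field,banach}"
  assumes "\<alpha> > 0" "norm_conv \<alpha> \<rho> c" "\<rho> > 0"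
    and u: "\<And>t. t \<in> right_open_ivl \<rho> \<Longrightarrow> u t = alpha_series \<alpha> c t"
  shows "norm_conv \<alpha> \<rho> (caputo_coeffs \<alpha> c) \<and>
    (\<forall>t \<in> right_open_ivl \<rho>. caputo_deriv \<alpha> u t = alpha_series \<alpha> (caputo_coeffs \<alpha> c) t)"
proof -
  define l where "l = frac_order \<alpha>"
  note l = frac_order_bounds[OF assms(1), folded l_def]
  let ?c = "\<lambda>m. c (Suc m)"
  have conv: "norm_conv \<alpha> \<rho> ?c" by (rule norm_conv_Suc[OF assms(1,2)])
  have z: "0 \<in> right_open_ivl \<rho>" using assms by (simp add: right_open_ivl_def zero_ereal_def)
  define \<phi> where "\<phi> = (\<lambda>x. u x - (\<Sum>k<l. (x ^ k / fact k) *\<^sub>R (half_line_deriv ^^ k) u 0))"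
  have "(\<Sum>k<l. (x ^ k / fact k) *\<^sub>R (half_line_deriv ^^ k) u 0) = c 0" for x
  proof -
    \<comment> \<open>Positive orders \<open>k < l\<close> satisfy
      \<open>k \<le> l - 1 < \<alpha>\<close>, hence their derivatives at 0 vanish.\<close>
    have "(x ^ k / fact k) *\<^sub>R (half_line_deriv ^^ k) u 0 = (if k = 0 then c 0 else 0)" if "k < l" for k
      using half_line_deriv_funpow_zero[OF assms(1-3) _ _ u, of k] that l u[OF z]
      by (cases "k = 0") (auto simp: less_eq_Suc_le)
    then have "(\<Sum>k<l. (x ^ k / fact k) *\<^sub>R (half_line_deriv ^^ k) u 0) = (\<Sum>k<l. if k = 0 then c 0 else 0)"
      by (intro sum.cong) auto
    then show ?thesis using l by simp
  qed
  then have \<phi>: "\<phi> t = shifted_series \<alpha> \<alpha> ?c t" if "t \<in> right_open_ivl \<rho>" for t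
    using u[OF that] alpha_series_split[OF assms(1,2) that] by (simp add: \<phi>_def)
  let ?d = "\<lambda>m. (Gamma (\<alpha> * real (Suc m) + 1) / Gamma (\<alpha> * real (Suc m) + 1 + (real l - \<alpha>))) *\<^sub>R ?c m"
  have "norm_conv \<alpha> \<rho> ?d" and
    int: "\<And>x. x \<in> right_open_ivl \<rho> \<Longrightarrow> frac_integral (real l - \<alpha>) \<phi> x = shifted_series \<alpha> (real l) ?d x"
    using frac_integral_shifted_series[OF assms(1) conv _ \<phi>, of "real l - \<alpha>"] l(2) by simp_all
  from half_line_deriv_funpow_shifted_series[OF assms(1) this(1) order_refl this(2)]
  have *: "norm_conv \<alpha> \<rho> (\<lambda>m. (\<Prod>j<l. \<alpha> * real m + real l - real j) *\<^sub>R ?d m) \<and>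
    (\<forall>t \<in> right_open_ivl \<rho>. (half_line_deriv ^^ l) (frac_integral (real l - \<alpha>) \<phi>) t =
     shifted_series \<alpha> (real l - real l) (\<lambda>m. (\<Prod>j<l. \<alpha> * real m + real l - real j) *\<^sub>R ?d m) t)" .
  have "(\<Prod>j<l. \<alpha> * real m + real l - real j) *\<^sub>R ?d m = caputo_coeffs \<alpha> c m" for m
  proof -
    have pos: "\<alpha> * real m + 1 > 0" using assms(1) by (intro add_nonneg_pos) auto
    then have "Gamma (\<alpha> * real m + 1) > 0" "Gamma (\<alpha> * real m + 1 + real l) > 0"
      by (intro Gamma_real_pos; simp)+
    moreover have "\<alpha> * real m + 1 \<notin> \<int>\<^sub>\<le>\<^sub>0"
      using pos by (auto elim!: nonpos_Ints_cases)
    then have "pochhammer (\<alpha> * real m + 1) l = Gamma (\<alpha> * real m + 1 + real l) / Gamma (\<alpha> * real m + 1)"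
      by (rule pochhammer_Gamma)
    moreover have eq: "\<alpha> * real (Suc m) + 1 + (real l - \<alpha>) = \<alpha> * real m + 1 + real l"
      by (simp add: algebra_simps)
    ultimately show ?thesis
      unfolding prod_descending_eq_pochhammer caputo_coeffs_def eq by simp
  qed
  then have eq: "(\<lambda>m. (\<Prod>j<l. \<alpha> * real m + real l - real j) *\<^sub>R ?d m) = caputo_coeffs \<alpha> c" by blast
  have "caputo_deriv \<alpha> u = (half_line_deriv ^^ l) (frac_integral (real l - \<alpha>) \<phi>)"
    by (simp add: caputo_deriv_def riemann_liouville_deriv_def l_def \<phi>_def)
  then show ?thesis using * unfolding eq by (simp add: shifted_series_def)
qed

text \<open>The weights of successive shifts telescope, the numerator of one being the denominator
  of another. Since the iterate agrees with its series on the whole interval, it can take the role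
  of \<open>u\<close> in the next step.\<close>

lemma caputo_deriv_funpow_alpha_series:
  fixes c :: "nat \<Rightarrow> 'a::{real_normed_field,banach}"
  assumes "\<alpha> > 0" "norm_conv \<alpha> \<rho> c" "\<rho> > 0"
    and u: "\<And>t. t \<in> right_open_ivl \<rho> \<Longrightarrow> u t = alpha_series \<alpha> c t"
  shows "norm_conv \<alpha> \<rho> (\<lambda>m. (Gamma (\<alpha> * real (m + j) + 1) / Gamma (\<alpha> * real m + 1)) *\<^sub>R c (m + j)) \<and>
    (\<forall>t \<in> right_open_ivl \<rho>. (caputo_deriv \<alpha> ^^ j) u t = alpha_series \<alpha>
      (\<lambda>m. (Gamma (\<alpha> * real (m + j) + 1) / Gamma (\<alpha> * real m + 1)) *\<^sub>R c (m + j)) t)"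
    (is "norm_conv \<alpha> \<rho> (?d j) \<and> _")
proof -
  have G: "Gamma (\<alpha> * real m + 1) \<noteq> 0" for m
    by (rule less_imp_neq[symmetric], intro Gamma_real_pos add_nonneg_pos) (use assms(1) in auto)
  show ?thesis
  proof (induction j)
    case 0
    show ?case using u assms(2) G by simp
  next
    case (Suc j)
    have "caputo_coeffs \<alpha> (?d j) = ?d (Suc j)"
      using G[of "Suc _"] by (simp add: fun_eq_iff caputo_coeffs_def add.assoc)
    then show ?case
      using caputo_deriv_alpha_series[OF assms(1) conjunct1[OF Suc] assms(3),
          of "(caputo_deriv \<alpha> ^^ j) u"] Suc by simp
  qed
qed

section \<open>Identity theorem and products\<close>

text \<open>Evaluation at 0 yields the first coefficient. Dividing by \<open>t powr \<alpha>\<close>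
  handles the remaining series for \<open>t > 0\<close>, and right continuity extends the result to
  \<open>t = 0\<close>.\<close>

lemma alpha_series_eq_0_imp_shift:
  fixes c :: "nat \<Rightarrow> 'a::{real_normed_field,banach}"
  assumes "\<alpha> > 0" "norm_conv \<alpha> \<rho> c" "\<rho> > 0"
    and zero: "\<And>t. t \<in> right_open_ivl \<rho> \<Longrightarrow> alpha_series \<alpha> c t = 0"
  shows "c 0 = 0" and "\<And>t. t \<in> right_open_ivl \<rho> \<Longrightarrow> alpha_series \<alpha> (\<lambda>m. c (Suc m)) t = 0"
proof -
  have z: "0 \<in> right_open_ivl \<rho>" using assms by (simp add: right_open_ivl_def zero_ereal_def)
  show c0: "c 0 = 0" using zero[OF z] by simp
  have pos: "alpha_series \<alpha> (\<lambda>m. c (Suc m)) t = 0" if "t \<in> right_open_ivl \<rho>" "t \<noteq> 0" for t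
    using alpha_series_split[OF assms(1,2) that(1)] zero[OF that(1)] c0 that assms(1)
    by (simp add: shifted_series_def)
  obtain t' where t': "t' \<in> right_open_ivl \<rho>" "0 < t'" using z by (rule right_open_ivl_larger)
  have "eventually (\<lambda>t. 0 = alpha_series \<alpha> (\<lambda>m. c (Suc m)) t) (at 0 within {0..})"
    unfolding eventually_at
  proof (intro exI[of _ t'] conjI ballI impI t'(2))
    fix t :: real assume "t \<in> {0..}" "t \<noteq> 0 \<and> dist t 0 < t'"
    then show "0 = alpha_series \<alpha> (\<lambda>m. c (Suc m)) t"
      by (subst pos) (auto intro: right_open_ivl_downward[OF t'(1)])
  qed
  then have "(alpha_series \<alpha> (\<lambda>m. c (Suc m)) \<longlongrightarrow> 0) (at 0 within {0..})"
    by (rule Lim_transform_eventually[OF tendsto_const])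
  moreover have "(alpha_series \<alpha> (\<lambda>m. c (Suc m)) \<longlongrightarrow> c (Suc 0)) (at 0 within {0..})"
    by (rule alpha_series_tendsto_0[OF assms(1) norm_conv_Suc[OF assms(1,2)] assms(3)])
  moreover have "at (0::real) within {0..} \<noteq> bot"
    using islimpt_subset[of "0::real" "{0..1}" "{0..}"] islimpt_Icc[of "0::real" 1]
    by (simp add: trivial_limit_within)
  ultimately have "c (Suc 0) = 0" using tendsto_unique by blast
  then show "alpha_series \<alpha> (\<lambda>m. c (Suc m)) t = 0" if "t \<in> right_open_ivl \<rho>" for t
    using pos[OF that] by (cases "t = 0") auto
qed

lemma alpha_series_eq_0_iff:
  fixes c :: "nat \<Rightarrow> 'a::{real_normed_field,banach}"
  assumes "\<alpha> > 0" "norm_conv \<alpha> \<rho> c" "\<rho> > 0"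
  shows "(\<forall>t\<in>right_open_ivl \<rho>. alpha_series \<alpha> c t = 0) \<longleftrightarrow> (\<forall>m. c m = 0)"
proof
  assume zero: "\<forall>t\<in>right_open_ivl \<rho>. alpha_series \<alpha> c t = 0"
  have *: "norm_conv \<alpha> \<rho> (\<lambda>j. c (j + m)) \<and> (\<forall>t\<in>right_open_ivl \<rho>. alpha_series \<alpha> (\<lambda>j. c (j + m)) t = 0)"
    for m
  proof (induction m)
    case (Suc m)
    then show ?case
      using norm_conv_Suc[OF assms(1), of \<rho> "\<lambda>j. c (j + m)"]
        alpha_series_eq_0_imp_shift(2)[OF assms(1) _ assms(3), of "\<lambda>j. c (j + m)"] by simp
  qed (use assms zero in simp)
  show "\<forall>m. c m = 0"
    using alpha_series_eq_0_imp_shift(1)[OF assms(1) _ assms(3), of "\<lambda>j. c (j + _)"] * by simp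
qed (simp add: alpha_series_def)

lemma norm_convI_sums:
  fixes c :: "nat \<Rightarrow> 'a::{real_normed_field,banach}"
  assumes "\<alpha> > 0" "\<And>t. t \<in> right_open_ivl \<rho> \<Longrightarrow> (\<lambda>m. ((t powr \<alpha>) ^ m) *\<^sub>R c m) sums u t"
  shows "norm_conv \<alpha> \<rho> c" "\<And>t. t \<in> right_open_ivl \<rho> \<Longrightarrow> alpha_series \<alpha> c t = u t"
  using assms(2) unfolding norm_conv_iff[OF assms(1)] alpha_series_def by (auto simp: sums_iff)

lemma alpha_series_mult:
  fixes c d :: "nat \<Rightarrow> 'a::{real_normed_field,banach}"
  assumes "\<alpha> > 0" "norm_conv \<alpha> \<rho> c" "norm_conv \<alpha> \<rho> d" "t \<in> right_open_ivl \<rho>"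
  shows "(\<lambda>m. ((t powr \<alpha>) ^ m) *\<^sub>R (\<Sum>i\<le>m. c i * d (m - i))) sums
    (alpha_series \<alpha> c t * alpha_series \<alpha> d t)"
proof -
  let ?w = "t powr \<alpha>"
  have "summable (\<lambda>m. norm (?w ^ m *\<^sub>R c m))" "summable (\<lambda>m. norm (?w ^ m *\<^sub>R d m))"
    using assms by (auto simp: norm_conv_def mult.commute)
  from Cauchy_product_sums[OF this]
  have "(\<lambda>m. \<Sum>i\<le>m. (?w ^ i *\<^sub>R c i) * (?w ^ (m - i) *\<^sub>R d (m - i))) sums
    (alpha_series \<alpha> c t * alpha_series \<alpha> d t)" unfolding alpha_series_def .
  moreover have "(\<Sum>i\<le>m. (?w ^ i *\<^sub>R c i) * (?w ^ (m - i) *\<^sub>R d (m - i)))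
      = ?w ^ m *\<^sub>R (\<Sum>i\<le>m. c i * d (m - i))" for m
    unfolding scaleR_sum_right by (intro sum.cong) (auto simp: power_add[symmetric])
  ultimately show ?thesis by simp
qed

section \<open>The initial value problem as a system of coefficient identities\<close>

lemma Gamma_alpha_pos: "\<alpha> > 0 \<Longrightarrow> Gamma (\<alpha> * real m + 1) > 0"
  by (intro Gamma_real_pos add_nonneg_pos) auto

text \<open>By Cauchy products the left-hand side of the equation is itself an \<alpha>-series, so
  the identity theorem makes it vanish exactly when all its coefficients \<open>E m\<close> do. The
  equivalence serves existence and uniqueness alike.\<close>

lemma solves_frac_ivp_alpha_series_iff:
  fixes c :: "nat \<Rightarrow> 'a::{real_normed_field,banach}"
  assumes "\<alpha> > 0" "norm_conv \<alpha> \<rho> c" "\<rho> > 0"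
    and u: "\<And>t. t \<in> right_open_ivl \<rho> \<Longrightarrow> u t = alpha_series \<alpha> c t"
    and P: "\<And>k. k < n \<Longrightarrow> norm_conv \<alpha> \<rho> (P k)"
    and p: "\<And>k t. k < n \<Longrightarrow> t \<in> right_open_ivl \<rho> \<Longrightarrow> p k t = alpha_series \<alpha> (P k) t"
  shows "solves_frac_ivp \<alpha> n \<rho> p b u \<longleftrightarrow>
    (\<forall>m. (Gamma (\<alpha> * real (m + n) + 1) / Gamma (\<alpha> * real m + 1)) *\<^sub>R c (m + n) +
      (\<Sum>k<n. \<Sum>i\<le>m. (Gamma (\<alpha> * real (i + k) + 1) / Gamma (\<alpha> * real i + 1)) *\<^sub>R c (i + k) * P k (m - i)) = 0) \<and>
    (\<forall>k<n. Gamma (\<alpha> * real k + 1) *\<^sub>R c k = b k)"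
proof -
  define D where "D = (\<lambda>j m. (Gamma (\<alpha> * real (m + j) + 1) / Gamma (\<alpha> * real m + 1)) *\<^sub>R c (m + j))"
  have D: "norm_conv \<alpha> \<rho> (D j)"
    "\<And>t. t \<in> right_open_ivl \<rho> \<Longrightarrow> (caputo_deriv \<alpha> ^^ j) u t = alpha_series \<alpha> (D j) t" for j
    using caputo_deriv_funpow_alpha_series[OF assms(1-3) u, of j] by (simp_all add: D_def)
  define E where "E = (\<lambda>m. D n m + (\<Sum>k<n. \<Sum>i\<le>m. D k i * P k (m - i)))"
  have E: "(\<lambda>m. ((t powr \<alpha>) ^ m) *\<^sub>R E m) sums
      ((caputo_deriv \<alpha> ^^ n) u t + (\<Sum>k<n. p k t * (caputo_deriv \<alpha> ^^ k) u t))"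
    if t: "t \<in> right_open_ivl \<rho>" for t
  proof -
    have "(\<lambda>m. ((t powr \<alpha>) ^ m) *\<^sub>R D n m + (\<Sum>k<n. ((t powr \<alpha>) ^ m) *\<^sub>R (\<Sum>i\<le>m. D k i * P k (m - i)))) sums
      (alpha_series \<alpha> (D n) t + (\<Sum>k<n. alpha_series \<alpha> (D k) t * alpha_series \<alpha> (P k) t))"
      by (intro sums_add sums_sum norm_conv_series[OF assms(1) D(1) t]
          alpha_series_mult[OF assms(1) D(1) P t]) simp
    moreover have "(\<Sum>k<n. alpha_series \<alpha> (D k) t * alpha_series \<alpha> (P k) t)
        = (\<Sum>k<n. p k t * (caputo_deriv \<alpha> ^^ k) u t)"
      by (intro sum.cong) (simp_all add: D(2)[OF t] p t)
    ultimately show ?thesis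
      by (simp add: E_def D(2)[OF t] scaleR_add_right scaleR_sum_right)
  qed
  have z: "0 \<in> right_open_ivl \<rho>" using assms by (simp add: right_open_ivl_def zero_ereal_def)
  have "(caputo_deriv \<alpha> ^^ k) u 0 = Gamma (\<alpha> * real k + 1) *\<^sub>R c k" for k
    using D(2)[OF z, of k] by (simp add: D_def)
  then have "solves_frac_ivp \<alpha> n \<rho> p b u \<longleftrightarrow> (\<forall>t\<in>right_open_ivl \<rho>. alpha_series \<alpha> E t = 0) \<and>
     (\<forall>k<n. Gamma (\<alpha> * real k + 1) *\<^sub>R c k = b k)"
    unfolding solves_frac_ivp_def using norm_convI_sums(2)[OF assms(1) E] by simp
  also have "(\<forall>t\<in>right_open_ivl \<rho>. alpha_series \<alpha> E t = 0) \<longleftrightarrow> (\<forall>m. E m = 0)"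
    by (rule alpha_series_eq_0_iff[OF assms(1) norm_convI_sums(1)[OF assms(1) E] assms(3)])
  finally show ?thesis unfolding E_def D_def .
qed

section \<open>The recursion for the coefficients\<close>

text \<open>The coefficient identity with \<open>j = m + n\<close>, solved for its highest
  coefficient. The recursive arguments satisfy \<open>i + k < j\<close> because
  \<open>i \<le> j - n\<close> and \<open>k < n\<close>.\<close>

function ivp_coeffs ::
  "real \<Rightarrow> nat \<Rightarrow> (nat \<Rightarrow> nat \<Rightarrow> 'a::real_normed_field) \<Rightarrow> (nat \<Rightarrow> 'a) \<Rightarrow> nat \<Rightarrow> 'a" where
  "ivp_coeffs \<alpha> n P b j =
     (if j < n then (1 / Gamma (\<alpha> * real j + 1)) *\<^sub>R b j
      else - ((Gamma (\<alpha> * real (j - n) + 1) / Gamma (\<alpha> * real j + 1)) *\<^sub>R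
        (\<Sum>k<n. \<Sum>i\<le>j - n. (Gamma (\<alpha> * real (i + k) + 1) / Gamma (\<alpha> * real i + 1)) *\<^sub>R
            ivp_coeffs \<alpha> n P b (i + k) * P k (j - n - i))))"
  by pat_completeness auto
termination
  by (relation "Wellfounded.measure (\<lambda>(\<alpha>, n, P, b, j). j)") auto

declare ivp_coeffs.simps [simp del]

text \<open>The factor of \<open>c (m + n)\<close> is positive, and all other coefficients in the
  \<open>m\<close>-th identity have smaller indices, so strong induction pins down the sequence.
  This is purely algebraic; convergence is treated separately.\<close>

lemma ivp_coeffs_iff:
  fixes c :: "nat \<Rightarrow> 'a::real_normed_field"
  assumes "\<alpha> > 0"
  shows "(\<forall>m. (Gamma (\<alpha> * real (m + n) + 1) / Gamma (\<alpha> * real m + 1)) *\<^sub>R c (m + n) +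
      (\<Sum>k<n. \<Sum>i\<le>m. (Gamma (\<alpha> * real (i + k) + 1) / Gamma (\<alpha> * real i + 1)) *\<^sub>R c (i + k) * P k (m - i)) = 0) \<and>
    (\<forall>k<n. Gamma (\<alpha> * real k + 1) *\<^sub>R c k = b k) \<longleftrightarrow> c = ivp_coeffs \<alpha> n P b"
    (is "(\<forall>m. ?g m *\<^sub>R c (m + n) + ?S c m = 0) \<and> ?init c \<longleftrightarrow> _")
proof
  let ?y = "ivp_coeffs \<alpha> n P b"
  note G = Gamma_alpha_pos[OF assms]
  have step: "x = - (inverse g *\<^sub>R s)" if "g *\<^sub>R x + s = 0" "g > 0" for x s :: 'a and g :: real
  proof -
    have "g *\<^sub>R x = - s" using that by (simp add: eq_neg_iff_add_eq_0)
    then have "inverse g *\<^sub>R (g *\<^sub>R x) = inverse g *\<^sub>R (- s)" by simp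
    then show ?thesis using that(2) by simp
  qed
  have init: "?y k = (1 / Gamma (\<alpha> * real k + 1)) *\<^sub>R b k" if "k < n" for k
    using that by (subst ivp_coeffs.simps) simp
  have rec: "?y (m + n) = - (inverse (?g m) *\<^sub>R ?S ?y m)" for m
    by (subst ivp_coeffs.simps) simp
  {
    assume c: "(\<forall>m. ?g m *\<^sub>R c (m + n) + ?S c m = 0) \<and> ?init c"
    have "c j = ?y j" for j
    proof (induction j rule: less_induct)
      case (less j)
      show ?case
      proof (cases "j < n")
        case True
        then have "b j = Gamma (\<alpha> * real j + 1) *\<^sub>R c j" using c by simp
        then show ?thesis using init[OF True] G[of j] by simp
      next
        case False
        then obtain m where m: "j = m + n" by (metis add.commute le_Suc_ex not_less)
        have "?S c m = ?S ?y m"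
        proof (intro sum.cong refl)
          fix k i assume "k \<in> {..<n}" "i \<in> {..m}"
          then have "i + k < j" by (auto simp: m)
          from less[OF this] show "(Gamma (\<alpha> * real (i + k) + 1) / Gamma (\<alpha> * real i + 1)) *\<^sub>R c (i + k) * P k (m - i)
            = (Gamma (\<alpha> * real (i + k) + 1) / Gamma (\<alpha> * real i + 1)) *\<^sub>R ?y (i + k) * P k (m - i)" by simp
        qed
        moreover have "c (m + n) = - (inverse (?g m) *\<^sub>R ?S c m)"
          using c G[of m] G[of "m + n"] by (intro step) (blast, simp)
        ultimately show ?thesis unfolding m rec by simp
      qed
    qed
    then show "c = ?y" by blast
  next
    assume c: "c = ?y"
    have "?g m *\<^sub>R ?y (m + n) + ?S ?y m = 0" for m
    proof -
      have "?g m \<noteq> 0" using G[of m] G[of "m + n"] by (metis divide_pos_pos less_irrefl)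
      then have "?g m *\<^sub>R (- (inverse (?g m) *\<^sub>R s)) + s = 0" for s :: 'a by simp
      then show ?thesis unfolding rec by blast
    qed
    moreover have "Gamma (\<alpha> * real k + 1) *\<^sub>R ?y k = b k" if "k < n" for k
      using init[OF that] G[of k] by simp
    ultimately show "(\<forall>m. ?g m *\<^sub>R c (m + n) + ?S c m = 0) \<and> ?init c" unfolding c by blast
  }
qed

section \<open>Growth of the recursively defined coefficients\<close>

text \<open>Because the bound involves all earlier terms, the partial sums rather than the terms
  obey a one-step recurrence: for large indices each is at most \<open>1 + \<delta>\<close> times
  its predecessor.\<close>

lemma summable_subexponential:
  fixes z \<epsilon> :: "nat \<Rightarrow> real"
  assumes nonneg: "\<And>m. 0 \<le> z m" and le: "\<And>m. z (m + n) \<le> \<epsilon> m * (\<Sum>j<m + n. z j)"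
    and \<epsilon>: "\<epsilon> \<longlonglongrightarrow> 0" and q: "0 \<le> q" "q < 1"
  shows "summable (\<lambda>m. z m * q ^ m)"
proof -
  \<comment> \<open>Half of the gap between \<open>q\<close> and 1: from
    \<open>\<delta> * q \<le> \<delta>\<close> it follows that
    \<open>(1 + \<delta>) * q \<le> (1 + q) / 2 < 1\<close>.\<close>
  define \<delta> where "\<delta> = (1 - q) / 2"
  have \<delta>: "\<delta> > 0" "(1 + \<delta>) * q < 1"
  proof -
    show "\<delta> > 0" using q by (simp add: \<delta>_def)
    have "\<delta> * q \<le> \<delta>" using q by (intro mult_left_le) (auto simp: \<delta>_def)
    then have "(1 + \<delta>) * q \<le> \<delta> + q" by (simp add: algebra_simps)
    also have "\<dots> < 1" using q by (simp add: \<delta>_def field_simps)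
    finally show "(1 + \<delta>) * q < 1" .
  qed
  have "eventually (\<lambda>m. \<epsilon> m < \<delta>) sequentially" using \<epsilon> \<delta>(1) by (rule order_tendstoD)
  then obtain M where M: "\<And>m. m \<ge> M \<Longrightarrow> \<epsilon> m < \<delta>" by (auto simp: eventually_sequentially)
  define Z where "Z = (\<lambda>N. \<Sum>j<N. z j)"
  \<comment> \<open>The offset \<open>n\<close> matches the hypothesis, which at index
    \<open>M + k\<close> bounds \<open>z (N + k)\<close>.\<close>
  define N where "N = M + n"
  have Z0: "Z m \<ge> 0" for m unfolding Z_def using nonneg by (intro sum_nonneg)
  have Z: "Z (N + k) \<le> Z N * (1 + \<delta>) ^ k" for k
  proof (induction k)
    case (Suc k)
    have "Z (N + Suc k) = Z (N + k) + z (N + k)" by (simp add: Z_def)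
    also have "z (N + k) \<le> \<epsilon> (M + k) * Z (N + k)"
      using le[of "M + k"] by (simp add: N_def Z_def add_ac)
    also have "\<dots> \<le> \<delta> * Z (N + k)" using M[of "M + k"] Z0 by (intro mult_right_mono) auto
    finally have "Z (N + Suc k) \<le> (1 + \<delta>) * Z (N + k)" by (simp add: algebra_simps)
    also have "\<dots> \<le> (1 + \<delta>) * (Z N * (1 + \<delta>) ^ k)" using Suc \<delta>(1) by (intro mult_left_mono) auto
    finally show ?case by (simp add: mult_ac)
  qed simp
  have "summable (\<lambda>k. z (k + N) * q ^ (k + N))"
  proof (rule summable_comparison_test')
    have "summable (\<lambda>k. ((1 + \<delta>) * q) ^ k)" using \<delta> q by (intro summable_geometric) simp
    then show "summable (\<lambda>k. (Z N * (1 + \<delta>) * q ^ N) * ((1 + \<delta>) * q) ^ k)" by (rule summable_mult)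
    fix k :: nat
    have "z (k + N) \<le> Z (N + Suc k)" using Z0[of "N + k"] by (simp add: Z_def add.commute)
    also have "\<dots> \<le> Z N * (1 + \<delta>) ^ Suc k" by (rule Z)
    finally have "z (k + N) * q ^ (k + N) \<le> Z N * (1 + \<delta>) ^ Suc k * q ^ (k + N)"
      using q by (intro mult_right_mono) auto
    then show "norm (z (k + N) * q ^ (k + N)) \<le> (Z N * (1 + \<delta>) * q ^ N) * ((1 + \<delta>) * q) ^ k"
      using nonneg q by (simp add: power_add power_mult_distrib mult_ac)
  qed
  then show ?thesis by (subst (asm) summable_iff_shift)
qed

lemma Gamma_ratio_eq_Beta:
  fixes x \<delta> :: real
  assumes "\<delta> > 0"
  shows "Gamma x / Gamma (x + \<delta>) = Beta x \<delta> / Gamma \<delta>"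
  using Gamma_real_pos[OF assms] by (simp add: Beta_def)

text \<open>The reciprocal quotient is a Beta value divided by \<open>Gamma \<delta>\<close>, and
  the Beta function decreases in its first argument.\<close>

lemma Gamma_ratio_mono:
  fixes x y \<delta> :: real
  assumes "0 < x" "x \<le> y" "0 \<le> \<delta>"
  shows "Gamma (x + \<delta>) / Gamma x \<le> Gamma (y + \<delta>) / Gamma y"
proof (cases "\<delta> = 0")
  case False
  then have \<delta>: "\<delta> > 0" using assms by simp
  have pos: "Gamma x > 0" "Gamma (x + \<delta>) > 0" "Gamma y > 0" "Gamma (y + \<delta>) > 0"
    using assms by (auto intro!: Gamma_real_pos)
  have "Beta y \<delta> / Gamma \<delta> \<le> Beta x \<delta> / Gamma \<delta>"
    using assms \<delta> by (intro divide_right_mono Beta_real_mono) (auto intro: less_imp_le Gamma_real_pos)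
  then have "Gamma y / Gamma (y + \<delta>) \<le> Gamma x / Gamma (x + \<delta>)"
    by (simp only: Gamma_ratio_eq_Beta[OF \<delta>])
  then show ?thesis using pos by (simp add: field_simps)
qed (use assms Gamma_real_pos[of x] Gamma_real_pos[of y] in \<open>simp del: Gamma_real_pos\<close>)

text \<open>Up to the factor \<open>Gamma \<delta>\<close> the quotient is a Beta integral, whose
  integrand tends to 0 pointwise as \<open>x m\<close> grows. The integrand at \<open>x = 1\<close>
  is an integrable majorant, whence the assumption \<open>x m \<ge> 1\<close>.\<close>

lemma tendsto_Gamma_ratio_0:
  fixes x :: "nat \<Rightarrow> real"
  assumes "\<delta> > 0" "\<And>m. x m \<ge> 1" "filterlim x at_top sequentially"
  shows "(\<lambda>m. Gamma (x m) / Gamma (x m + \<delta>)) \<longlonglongrightarrow> 0"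
proof -
  define f where "f = (\<lambda>y t::real. t powr (y - 1) * (1 - t) powr (\<delta> - 1))"
  have f: "(f y has_integral Beta y \<delta>) {0..1}" if "y \<ge> 1" for y
    unfolding f_def using that assms(1) by (intro has_integral_Beta_real) auto
  have "(\<lambda>m. integral {0..1} (f (x m))) \<longlonglongrightarrow> integral {0..1::real} (\<lambda>t. 0)"
  proof (rule dominated_convergence)
    show "f (x m) integrable_on {0..1}" for m using f[OF assms(2)] by (rule has_integral_integrable)
    show "f 1 integrable_on {0..1}" using f[of 1] by (intro has_integral_integrable) simp
    show "norm (f (x m) t) \<le> f 1 t" if "t \<in> {0..1}" for m t
    proof (cases "t = 0")
      case False
      then have "t powr (x m - 1) \<le> t powr (1 - 1)" using that assms(2)[of m] by (intro powr_mono') auto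
      from mult_right_mono[OF this, of "(1 - t) powr (\<delta> - 1)"] show ?thesis by (simp add: f_def abs_mult)
    qed (simp add: f_def)
    show "(\<lambda>m. f (x m) t) \<longlonglongrightarrow> 0" if "t \<in> {0..1}" for t
    \<comment> \<open>At both endpoints the integrand is 0, since \<open>0 powr a = 0\<close> for
      every \<open>a\<close>.\<close>
    proof (cases "t = 0 \<or> t = 1")
      case False
      with that have t: "0 < t" "t < 1" by auto
      have "filterlim (\<lambda>m. - 1 + x m) at_top sequentially"
        by (rule filterlim_tendsto_add_at_top[OF tendsto_const assms(3)])
      then have "filterlim (\<lambda>m. ln t * (x m - 1)) at_bot sequentially"
        using t by (intro filterlim_tendsto_neg_mult_at_bot[OF tendsto_const]) auto
      then have "(\<lambda>m. exp (ln t * (x m - 1))) \<longlonglongrightarrow> 0"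
        by (rule filterlim_compose[OF exp_at_bot])
      then have "(\<lambda>m. t powr (x m - 1)) \<longlonglongrightarrow> 0"
        using t by (simp add: powr_def mult.commute)
      then show ?thesis unfolding f_def by (rule tendsto_mult_left_zero)
    qed (auto simp: f_def)
  qed
  moreover have "integral {0..1} (f (x m)) = Beta (x m) \<delta>" for m
    using f[OF assms(2)] by (rule integral_unique)
  ultimately have "(\<lambda>m. Beta (x m) \<delta> / Gamma \<delta>) \<longlonglongrightarrow> 0"
    by (simp add: tendsto_divide_zero)
  then show ?thesis by (simp only: Gamma_ratio_eq_Beta[OF assms(1)])
qed

text \<open>\<open>Gamma (x + \<delta>) / Gamma x\<close> increases in \<open>x\<close>, so the quotients at \<open>i \<le> m\<close> in the recursion are
  dominated by the one at \<open>m\<close>; this leaves the factors \<open>G (m + k) / G (m + n)\<close> with \<open>k < n\<close>, which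
  tend to \<open>0\<close>.\<close>

lemma norm_conv_ivp_coeffs:
  fixes P :: "nat \<Rightarrow> nat \<Rightarrow> 'a::real_normed_field"
  assumes "\<alpha> > 0" and P: "\<And>k. k < n \<Longrightarrow> norm_conv \<alpha> \<rho> (P k)"
  shows "norm_conv \<alpha> \<rho> (ivp_coeffs \<alpha> n P b)"
  unfolding norm_conv_def
proof
  fix t assume t: "t \<in> right_open_ivl \<rho>"
  then obtain t' where t': "t' \<in> right_open_ivl \<rho>" "t < t'" by (rule right_open_ivl_larger)
  define w where "w = t powr \<alpha>"
  define w' where "w' = t' powr \<alpha>"
  have w: "0 \<le> w" "w < w'" using assms(1) t t'
    by (auto simp: w_def w'_def right_open_ivl_def intro!: powr_less_mono2)
  define c where "c = ivp_coeffs \<alpha> n P b"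
  define G where "G = (\<lambda>m. Gamma (\<alpha> * real m + 1))"
  have G: "G m > 0" for m unfolding G_def by (rule Gamma_alpha_pos[OF assms(1)])
  define z where "z = (\<lambda>m. norm (c m) * w' ^ m)"
  have z0: "z m \<ge> 0" for m using w by (simp add: z_def)
  \<comment> \<open>Each term of a convergent nonnegative series is at most its sum; adding the sums
    over \<open>k\<close> gives one bound for all the weighted coefficients of the
    \<open>P k\<close>.\<close>
  define M where "M = (\<Sum>k<n. \<Sum>i. norm (P k i) * w' ^ i)"
  have sP: "summable (\<lambda>i. norm (P k i) * w' ^ i)" if "k < n" for k
    using P[OF that] t'(1) by (simp add: norm_conv_def w'_def)
  have sP0: "0 \<le> (\<Sum>i. norm (P k i) * w' ^ i)" if "k < n" for k
    using w by (intro suminf_nonneg sP[OF that]) auto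
  have M: "norm (P k i) * w' ^ i \<le> M" if "k < n" for k i
  proof -
    have "norm (P k i) * w' ^ i \<le> (\<Sum>i. norm (P k i) * w' ^ i)"
      using sum_le_suminf[OF sP[OF that], of "{i}"] w by simp
    also have "\<dots> \<le> M" unfolding M_def using that sP0 by (intro member_le_sum) auto
    finally show ?thesis .
  qed
  have M0: "M \<ge> 0" unfolding M_def using sP0 by (intro sum_nonneg) auto
  \<comment> \<open>The base \<open>1 + w'\<close> is at least 1, so its \<open>n\<close>-th power
    dominates every \<open>w' ^ (n - k)\<close> even when \<open>w' < 1\<close>.\<close>
  define W where "W = (1 + w') ^ n"
  have W: "w' ^ (n - k) \<le> W" for k
  proof -
    have "w' ^ (n - k) \<le> (1 + w') ^ (n - k)" using w by (intro power_mono) auto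
    also have "\<dots> \<le> W" unfolding W_def using w by (intro power_increasing) auto
    finally show ?thesis .
  qed
  have W0: "W \<ge> 0" using w by (simp add: W_def)
  define \<epsilon> where "\<epsilon> = (\<lambda>m. W * M * (\<Sum>k<n. G (m + k) / G (m + n)))"
  have "summable (\<lambda>m. z m * (w / w') ^ m)"
  proof (rule summable_subexponential[OF z0])
    show "0 \<le> w / w'" "w / w' < 1" using w by auto
    have "(\<lambda>m. G (m + k) / G (m + n)) \<longlonglongrightarrow> 0" if "k < n" for k
    proof -
      \<comment> \<open>The denominator \<open>G (m + n)\<close> is reached from the argument of
        \<open>G (m + k)\<close> by adding \<open>\<alpha> * (n - k)\<close>, which is positive
        because \<open>k < n\<close>.\<close>
      have "(\<lambda>m. Gamma (\<alpha> * real (m + k) + 1) / Gamma (\<alpha> * real (m + k) + 1 + \<alpha> * real (n - k))) \<longlonglongrightarrow> 0"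
      proof (rule tendsto_Gamma_ratio_0)
        have "filterlim (\<lambda>m. (\<alpha> * real k + 1) + \<alpha> * real m) at_top sequentially"
          by (intro filterlim_tendsto_add_at_top[OF tendsto_const]
              filterlim_tendsto_pos_mult_at_top[OF tendsto_const assms(1)] filterlim_real_sequentially)
        then show "filterlim (\<lambda>m. \<alpha> * real (m + k) + 1) at_top sequentially"
          by (simp add: algebra_simps)
      qed (use assms(1) that in auto)
      moreover have "\<alpha> * real (m + k) + 1 + \<alpha> * real (n - k) = \<alpha> * real (m + n) + 1" for m
        using that by (simp add: of_nat_diff algebra_simps)
      ultimately show ?thesis by (simp only: G_def)
    qed
    then have "(\<lambda>m. W * M * (\<Sum>k<n. G (m + k) / G (m + n))) \<longlonglongrightarrow> W * M * (\<Sum>k<n. 0)"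
      by (intro tendsto_intros) auto
    then show "\<epsilon> \<longlonglongrightarrow> 0" by (simp add: \<epsilon>_def)
    show "z (m + n) \<le> \<epsilon> m * (\<Sum>j<m + n. z j)" for m
    proof -
      let ?Z = "\<Sum>j<m + n. z j"
      have "c (m + n) = - ((G m / G (m + n)) *\<^sub>R
          (\<Sum>k<n. \<Sum>i\<le>m. (G (i + k) / G i) *\<^sub>R c (i + k) * P k (m - i)))"
        unfolding c_def G_def by (subst ivp_coeffs.simps) simp
      then have "norm (c (m + n)) = (G m / G (m + n)) *
          norm (\<Sum>k<n. \<Sum>i\<le>m. (G (i + k) / G i) *\<^sub>R c (i + k) * P k (m - i))"
        using G[of m] G[of "m + n"] by simp
      also have "\<dots> \<le> (G m / G (m + n)) *
          (\<Sum>k<n. \<Sum>i\<le>m. norm ((G (i + k) / G i) *\<^sub>R c (i + k) * P k (m - i)))"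
        using G[of m] G[of "m + n"]
        by (intro mult_left_mono order_trans[OF norm_sum] sum_mono norm_sum) auto
      finally have "z (m + n) \<le> (G m / G (m + n)) *
          (\<Sum>k<n. \<Sum>i\<le>m. norm ((G (i + k) / G i) *\<^sub>R c (i + k) * P k (m - i))) * w' ^ (m + n)"
        unfolding z_def using w by (intro mult_right_mono) auto
      also have "\<dots> = (\<Sum>k<n. \<Sum>i\<le>m. (G m / G (m + n)) *
          (norm ((G (i + k) / G i) *\<^sub>R c (i + k) * P k (m - i)) * w' ^ (m + n)))"
        by (simp only: sum_distrib_left sum_distrib_right mult.assoc)
      also have "\<dots> \<le> (\<Sum>k<n. \<Sum>i\<le>m. (W * M * (G (m + k) / G (m + n))) * z (i + k))"
      proof (intro sum_mono)
        fix k i assume "k \<in> {..<n}" "i \<in> {..m}"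
        then have ki: "k < n" "i \<le> m" by auto
        have ratio: "G (i + k) / G i \<le> G (m + k) / G m"
        proof -
          have "\<alpha> * real i \<le> \<alpha> * real m" "0 \<le> \<alpha> * real i" using assms(1) ki by auto
          then have "Gamma (\<alpha> * real i + 1 + \<alpha> * real k) / Gamma (\<alpha> * real i + 1)
              \<le> Gamma (\<alpha> * real m + 1 + \<alpha> * real k) / Gamma (\<alpha> * real m + 1)"
            using assms(1) by (intro Gamma_ratio_mono add_nonneg_pos) auto
          then show ?thesis by (simp add: G_def algebra_simps)
        qed
        have "norm ((G (i + k) / G i) *\<^sub>R c (i + k) * P k (m - i)) * w' ^ (m + n)
            = (G (i + k) / G i) * (w' ^ (n - k) * ((norm (P k (m - i)) * w' ^ (m - i)) * z (i + k)))"
        proof -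
          \<comment> \<open>Of the \<open>m + n\<close> powers of \<open>w'\<close>,
            \<open>m - i\<close> go to the coefficient of \<open>P k\<close> and
            \<open>i + k\<close> turn \<open>norm (c (i + k))\<close> into \<open>z (i + k)\<close>;
            the surplus \<open>n - k\<close> is absorbed by \<open>W\<close>.\<close>
          have "m + n = (n - k) + ((m - i) + (i + k))" using ki by simp
          then have "w' ^ (m + n) = w' ^ (n - k) * (w' ^ (m - i) * w' ^ (i + k))"
            by (metis power_add)
          then show ?thesis using G[of i] G[of "i + k"] by (simp add: z_def norm_mult mult_ac)
        qed
        also have "\<dots> \<le> (G (m + k) / G m) * (W * (M * z (i + k)))"
          using G[of m] G[of "m + k"] W0 M0 w z0
          by (intro mult_mono ratio W M[OF ki(1)] mult_nonneg_nonneg) (auto intro: less_imp_le)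
        finally have "(G m / G (m + n)) * (norm ((G (i + k) / G i) *\<^sub>R c (i + k) * P k (m - i)) * w' ^ (m + n))
            \<le> (G m / G (m + n)) * ((G (m + k) / G m) * (W * (M * z (i + k))))"
          using G[of m] G[of "m + n"] by (intro mult_left_mono) auto
        also have "\<dots> = (W * M * (G (m + k) / G (m + n))) * z (i + k)"
          using G[of m] by simp
        finally show "(G m / G (m + n)) * (norm ((G (i + k) / G i) *\<^sub>R c (i + k) * P k (m - i)) * w' ^ (m + n))
            \<le> (W * M * (G (m + k) / G (m + n))) * z (i + k)" .
      qed
      also have "\<dots> \<le> (\<Sum>k<n. (W * M * (G (m + k) / G (m + n))) * ?Z)"
      proof (intro sum_mono)
        fix k assume k: "k \<in> {..<n}"
        \<comment> \<open>For fixed \<open>k < n\<close> the shifted indices are distinct and stay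
          below \<open>m + n\<close>, so this is a part of the nonnegative sum
          \<open>?Z\<close>.\<close>
        have "(\<Sum>i\<le>m. z (i + k)) = (\<Sum>j\<in>(\<lambda>i. i + k) ` {..m}. z j)"
          by (subst sum.reindex) auto
        also have "\<dots> \<le> ?Z" using k z0 by (intro sum_mono2) auto
        finally show "(\<Sum>i\<le>m. (W * M * (G (m + k) / G (m + n))) * z (i + k))
            \<le> (W * M * (G (m + k) / G (m + n))) * ?Z"
          unfolding sum_distrib_left[symmetric]
          using W0 M0 G[of "m + k"] G[of "m + n"] by (intro mult_left_mono) auto
      qed
      also have "\<dots> = \<epsilon> m * ?Z"
        by (simp only: \<epsilon>_def sum_distrib_left[symmetric] sum_distrib_right[symmetric])
      finally show ?thesis .
    qed
  qed
  moreover have "z m * (w / w') ^ m = norm (c m) * w ^ m" for m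
    using w by (simp add: z_def power_divide)
  ultimately show "summable (\<lambda>m. norm (ivp_coeffs \<alpha> n P b m) * (t powr \<alpha>) ^ m)"
    by (simp add: c_def w_def)
qed

section \<open>Existence and uniqueness on the common interval\<close>

theorem theorem2:
  fixes \<alpha> :: real and n :: nat and r :: "nat \<Rightarrow> ereal" and \<rho> :: ereal
    and p :: "nat \<Rightarrow> real \<Rightarrow> 'a::{real_normed_field,banach}" and b :: "nat \<Rightarrow> 'a"
  assumes "\<alpha> > 0" and "n \<ge> 1"
    and "\<And>k. k < n \<Longrightarrow> r k > 0"
    and "\<And>k. k < n \<Longrightarrow> alpha_analytic \<alpha> (r k) (p k)"
    and "\<rho> = Min (r ` {..<n})"
  shows "\<exists>y. alpha_analytic \<alpha> \<rho> y \<and> solves_frac_ivp \<alpha> n \<rho> p b y \<and>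
           (\<forall>z. alpha_analytic \<alpha> \<rho> z \<and> solves_frac_ivp \<alpha> n \<rho> p b z \<longrightarrow>
                (\<forall>x\<in>right_open_ivl \<rho>. z x = y x))"
proof -
  have "r ` {..<n} \<noteq> {}" using assms(2) by (simp add: lessThan_empty_iff)
  then have \<rho>: "\<rho> > 0" using assms(3) unfolding assms(5) by (subst Min_gr_iff) auto
  have \<rho>_le: "\<rho> \<le> r k" if "k < n" for k using that unfolding assms(5) by (intro Min_le) auto
  have "\<exists>c. norm_conv \<alpha> (r k) c \<and> (\<forall>t\<in>right_open_ivl (r k). p k t = alpha_series \<alpha> c t)"
    if "k < n" for k
    using assms(4)[OF that] unfolding alpha_analytic_iff[OF assms(1)] .
  then obtain P where P: "\<And>k. k < n \<Longrightarrow> norm_conv \<alpha> (r k) (P k)"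
    "\<And>k t. k < n \<Longrightarrow> t \<in> right_open_ivl (r k) \<Longrightarrow> p k t = alpha_series \<alpha> (P k) t"
    by metis
  have P_conv: "norm_conv \<alpha> \<rho> (P k)" if "k < n" for k
    using norm_conv_mono[OF P(1) \<rho>_le] that by blast
  have p_eq: "p k t = alpha_series \<alpha> (P k) t" if "k < n" "t \<in> right_open_ivl \<rho>" for k t
    using that \<rho>_le[OF that(1)] by (intro P(2)) (auto simp: right_open_ivl_def)
  \<comment> \<open>One equivalence for arbitrary series: taking \<open>c\<close> to be the
    recursive sequence gives existence, and taking the coefficients of any other \<alpha>-analytic
    solution gives uniqueness.\<close>
  have solves: "solves_frac_ivp \<alpha> n \<rho> p b u \<longleftrightarrow> c = ivp_coeffs \<alpha> n P b"
    if "norm_conv \<alpha> \<rho> c" "\<And>t. t \<in> right_open_ivl \<rho> \<Longrightarrow> u t = alpha_series \<alpha> c t" for u c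
    unfolding ivp_coeffs_iff[OF assms(1), symmetric]
    by (rule solves_frac_ivp_alpha_series_iff[OF assms(1) that(1) \<rho> that(2) P_conv p_eq])
  let ?y = "alpha_series \<alpha> (ivp_coeffs \<alpha> n P b)"
  have conv: "norm_conv \<alpha> \<rho> (ivp_coeffs \<alpha> n P b)"
    by (rule norm_conv_ivp_coeffs[OF assms(1) P_conv])
  show ?thesis
  proof (intro exI[of _ ?y] conjI allI impI)
    show "alpha_analytic \<alpha> \<rho> ?y" using conv unfolding alpha_analytic_iff[OF assms(1)] by blast
    show "solves_frac_ivp \<alpha> n \<rho> p b ?y" using solves[OF conv] by simp
    fix z assume "alpha_analytic \<alpha> \<rho> z \<and> solves_frac_ivp \<alpha> n \<rho> p b z"
    then obtain c where "norm_conv \<alpha> \<rho> c" "\<And>t. t \<in> right_open_ivl \<rho> \<Longrightarrow> z t = alpha_series \<alpha> c t"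
      "solves_frac_ivp \<alpha> n \<rho> p b z"
      unfolding alpha_analytic_iff[OF assms(1)] by blast
    then show "\<forall>x\<in>right_open_ivl \<rho>. z x = ?y x" using solves by simp
  qed
qed

end
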